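(* Let $k\in\mathbb{N}$ and let $\mathbf{N}=(N_1,\ldots,N_{2^k})$ be a tuple of normal subgroups of a group $G$. Assume that $N_i=\langle S_i\rangle$ for every $i=1,\ldots,2^k$, where: (i) $S_i$ is a normal subset of $G$; (ii) there exists $n_i\in\mathbb{N}$ such that all $n_i$th powers of elements of $N_i$ are contained in $S_i$. If for the tuple $\mathbf{S}=(S_1,\ldots,S_{2^k})$ the set of values $\delta_k\{\mathbf{S}\}$ is finite of order $m$, then the subgroup $\delta_k(\mathbf{N})$ is also finite and of $(m,k,n_1,\ldots,n_{2^k})$-bounded order.
   Context: $\mathbb{N}$ denotes the positive integers. A subset of $G$ is normal if it is invariant under conjugation by all elements of $G$. For a word $w=w(x_1,\ldots,x_r)$ and a tuple $\mathbf{S}=(S_1,\ldots,S_r)$ of subsets of $G$, $w\{\mathbf{S}\}=\{w(g_1,\ldots,g_r)\mid g_i\in S_i\}$ and $w(\mathbf{S})=\langle w\{\mathbf{S}\}\rangle$. Commutators are $[x,y]=x^{-1}y^{-1}xy$. The derived words are defined by $\delta_0=x_1$ and $\delta_k(x_1,\ldots,x_{2^k})=[\delta_{k-1}(x_1,\ldots,x_{2^{k-1}}),\delta_{k-1}(x_{2^{k-1}+1},\ldots,x_{2^k})]$. "$(m,k,n_1,\ldots,n_{2^k})$-bounded" means bounded by a function depending only on $m,k,n_1,\ldots,n_{2^k}$ (and not on $G$, the $N_i$ or the $S_i$). *)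

theory Defs
  imports "HOL-Algebra.Generated_Groups"
begin

text \<open>
  Tuples of length \<open>r\<close> are functions on \<open>nat\<close> of which only the values at indices
  \<open>0, ..., r - 1\<close> matter; indices are thus shifted by one against the usual \<open>1, ..., r\<close>.
  A word in \<open>r\<close> variables enters through its word map \<open>(nat \<Rightarrow> 'a) \<Rightarrow> 'a\<close>.
\<close>

definition word_values :: "nat \<Rightarrow> ((nat \<Rightarrow> 'a) \<Rightarrow> 'a) \<Rightarrow> (nat \<Rightarrow> 'a set) \<Rightarrow> 'a set"
  where "word_values r w S = {w g | g. \<forall>i<r. g i \<in> S i}"

definition word_subgroup ::
    "('a, 'b) monoid_scheme \<Rightarrow> nat \<Rightarrow> ((nat \<Rightarrow> 'a) \<Rightarrow> 'a) \<Rightarrow> (nat \<Rightarrow> 'a set) \<Rightarrow> 'a set"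
  where "word_subgroup G r w S = generate G (word_values r w S)"

definition commutator :: "('a, 'b) monoid_scheme \<Rightarrow> 'a \<Rightarrow> 'a \<Rightarrow> 'a"
  where "commutator G x y = inv\<^bsub>G\<^esub> x \<otimes>\<^bsub>G\<^esub> inv\<^bsub>G\<^esub> y \<otimes>\<^bsub>G\<^esub> x \<otimes>\<^bsub>G\<^esub> y"

primrec derived_word :: "('a, 'b) monoid_scheme \<Rightarrow> nat \<Rightarrow> (nat \<Rightarrow> 'a) \<Rightarrow> 'a"
  where
    "derived_word G 0 x = x 0"
  | "derived_word G (Suc k) x =
       commutator G (derived_word G k x) (derived_word G k (\<lambda>i. x (2 ^ k + i)))"

definition normal_subset :: "'a set \<Rightarrow> ('a, 'b) monoid_scheme \<Rightarrow> bool"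
  where "normal_subset S G \<longleftrightarrow> S \<subseteq> carrier G \<and>
    (\<forall>g\<in>carrier G. \<forall>s\<in>S. inv\<^bsub>G\<^esub> g \<otimes>\<^bsub>G\<^esub> s \<otimes>\<^bsub>G\<^esub> g \<in> S)"

definition power_generated ::
    "'a monoid \<Rightarrow> nat \<Rightarrow> (nat \<Rightarrow> 'a set) \<Rightarrow> (nat \<Rightarrow> 'a set) \<Rightarrow> (nat \<Rightarrow> nat) \<Rightarrow> bool"
  where "power_generated G r N S n \<longleftrightarrow>
    (\<forall>i<r. N i \<lhd> G \<and> N i = generate G (S i) \<and> normal_subset (S i) G \<and>
       n i \<ge> 1 \<and> (\<forall>x\<in>N i. x [^]\<^bsub>G\<^esub> n i \<in> S i))"

text \<open>
  \<open>B\<close> bounds the order of the subgroup \<open>\<delta>\<^sub>k(N)\<close> in terms of \<open>m\<close>, \<open>k\<close> and the list of the exponents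
  \<open>n i\<close>, \<open>i < 2 ^ k\<close>, for all groups whose elements are of type \<open>'a\<close>.
\<close>

definition derived_order_bound :: "'a itself \<Rightarrow> (nat \<Rightarrow> nat \<Rightarrow> nat list \<Rightarrow> nat) \<Rightarrow> bool"
  where "derived_order_bound TYPE('a) B \<longleftrightarrow>
    (\<forall>k\<ge>1. \<forall>(G :: 'a monoid) N S n m.
       group G \<and> power_generated G (2 ^ k) N S n \<and>
       finite (word_values (2 ^ k) (derived_word G k) S) \<and>
       card (word_values (2 ^ k) (derived_word G k) S) = m \<longrightarrow>
       finite (word_subgroup G (2 ^ k) (derived_word G k) N) \<and>
       card (word_subgroup G (2 ^ k) (derived_word G k) N) \<le> B m k (map n [0..<2 ^ k]))"

text \<open>
  A formula cannot quantify over types, so the function \<open>B\<close> in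
  \<open>\<exists>B. derived_order_bound TYPE('a) B\<close> might still vary with the type \<open>'a\<close>.
  That one function serves all groups whatsoever is expressed by the additional claim
  \<open>derived_order_bound TYPE(nat) B \<longrightarrow> derived_order_bound TYPE('a) B\<close>: every bound
  that is valid for the groups on subsets of \<open>nat\<close> is valid over any type \<open>'a\<close>.
\<close>

end

theory Submission
  imports Defs "HOL-Library.Countable_Set"
begin

text \<open>
  Let \<open>K = \<delta>\<^sub>k(N)\<close>. It is generated by the normal set of the \<open>m\<close> values on \<open>S\<close>, so its
  centralizer \<open>C\<close> has bounded index in \<open>G\<close>. The main step shows that replacing one \<open>N\<^sub>i\<close> by
  \<open>N\<^sub>i \<inter> C\<close> yields a subgroup of bounded exponent modulo \<open>K'\<close>. Where the word is linear in an argument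
  \<open>x\<^sub>i\<close> modulo a normal subgroup, powers of \<open>x\<^sub>i\<close>, which can be chosen in \<open>S\<^sub>i\<close>, turn into
  powers of the value, and the pigeonhole principle on the \<open>m\<close> values gives torsion. Linearity is
  obtained for \<open>N\<^sub>i \<inter> P\<close>, \<open>P \<le> C\<close> normal, by induction on the number of nodes of the commutator
  tree whose subgroup does not contain \<open>P\<close>: if \<open>P \<le> K\<close> then \<open>P\<close> is abelian, and otherwise
  the errors lie in terms with \<open>P \<inter> D\<close> in place of \<open>P\<close>, where \<open>D\<close> is the subgroup of such a node.
  A relative version of Schur's theorem then bounds the index in \<open>K\<close> of the torsion subgroup modulo
  \<open>K'\<close> and the order of \<open>K'\<close>, hence the exponent of \<open>K\<close>, and Dietzmann's lemma bounds the
  order of \<open>K\<close>.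
\<close>

section \<open>Commutators of normal subgroups\<close>

text \<open>Hypothesis (ii) puts only powers of elements of \<open>N i\<close> into
  \<open>S i\<close>, so the finiteness of the set of values can reach arbitrary arguments only
  through powers. Because \<open>[x y, z] = y^-1 [x, z] y [y, z]\<close>, a power of an argument
  becomes a power of the value only modulo error terms, and controlling these is the main work.
  Results are collected modulo \<open>K'\<close> since \<open>K / K'\<close> is abelian: there the
  elements killed by a given power form a subgroup, so that it is enough to test generators. Most
  statements about the tree have a normal subgroup \<open>T\<close> as target and descend by the
  equivalence of \<open>[A, B] \<le> T\<close> and \<open>A \<le> colon T B\<close>, which absorbs
  the branch not entered into the target. Schur's theorem has to be relative for the same reason:
  index bounds are at hand only at the leaves, where \<open>N i \<inter> C\<close> has bounded index
  in \<open>N i\<close>, and they must be carried upwards through one commutator at a time, each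
  time modulo another subgroup. The main induction ends after at most as many rounds as the tree has
  nodes, so all exponents are independent of \<open>G\<close>.\<close>

context group
begin

lemma inv_cancel_left [simp]:
  assumes "x \<in> carrier G" "y \<in> carrier G"
  shows "x \<otimes> (inv x \<otimes> y) = y" "inv x \<otimes> (x \<otimes> y) = y"
  using assms by (simp_all flip: m_assoc)

lemma commutator_closed [simp]:
  "x \<in> carrier G \<Longrightarrow> y \<in> carrier G \<Longrightarrow> commutator G x y \<in> carrier G"
  by (simp add: commutator_def)

lemma inv_commutator:
  "x \<in> carrier G \<Longrightarrow> y \<in> carrier G \<Longrightarrow> inv (commutator G x y) = commutator G y x"
  by (simp add: commutator_def inv_mult_group m_assoc)

lemma commutator_one [simp]:
  "x \<in> carrier G \<Longrightarrow> commutator G x \<one> = \<one>" "x \<in> carrier G \<Longrightarrow> commutator G \<one> x = \<one>"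
  by (simp_all add: commutator_def)

lemma commutator_mult_left:
  "\<lbrakk>x \<in> carrier G; y \<in> carrier G; z \<in> carrier G\<rbrakk> \<Longrightarrow>
    commutator G (x \<otimes> y) z = inv y \<otimes> commutator G x z \<otimes> y \<otimes> commutator G y z"
  by (simp add: commutator_def inv_mult_group m_assoc)

lemma commutator_inv_left:
  "\<lbrakk>x \<in> carrier G; z \<in> carrier G\<rbrakk> \<Longrightarrow>
    commutator G (inv x) z = x \<otimes> inv (commutator G x z) \<otimes> inv x"
  by (simp add: commutator_def inv_mult_group m_assoc)

lemma conj_commutator:
  "\<lbrakk>x \<in> carrier G; y \<in> carrier G; z \<in> carrier G\<rbrakk> \<Longrightarrow>
    inv z \<otimes> commutator G x y \<otimes> z =
    commutator G (inv z \<otimes> x \<otimes> z) (inv z \<otimes> y \<otimes> z)"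
  by (simp add: commutator_def inv_mult_group m_assoc)

lemma Hall_Witt:
  "\<lbrakk>x \<in> carrier G; y \<in> carrier G; z \<in> carrier G\<rbrakk> \<Longrightarrow>
    inv y \<otimes> commutator G (commutator G x (inv y)) z \<otimes> y \<otimes>
    (inv z \<otimes> commutator G (commutator G y (inv z)) x \<otimes> z) \<otimes>
    (inv x \<otimes> commutator G (commutator G z (inv x)) y \<otimes> x) = \<one>"
  by (simp add: commutator_def inv_mult_group m_assoc)

lemma commute_iff_commutator:
  assumes "x \<in> carrier G" "y \<in> carrier G"
  shows "commutator G x y = \<one> \<longleftrightarrow> x \<otimes> y = y \<otimes> x"
proof -
  have "y \<otimes> x \<otimes> commutator G x y = x \<otimes> y"
    using assms by (simp add: commutator_def m_assoc)
  then show ?thesis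
    using assms by (metis commutator_closed l_cancel_one m_closed r_one)
qed

lemma normal_closed:
  assumes "T \<lhd> G"
  shows "T \<subseteq> carrier G" "\<one> \<in> T" "x \<in> T \<Longrightarrow> inv x \<in> T" "x \<in> T \<Longrightarrow> y \<in> T \<Longrightarrow> x \<otimes> y \<in> T"
    "x \<in> T \<Longrightarrow> z \<in> carrier G \<Longrightarrow> inv z \<otimes> x \<otimes> z \<in> T"
    "x \<in> T \<Longrightarrow> z \<in> carrier G \<Longrightarrow> z \<otimes> x \<otimes> inv z \<in> T"
    "x \<in> T \<Longrightarrow> z \<in> carrier G \<Longrightarrow> commutator G x z \<in> T"
    "x \<in> T \<Longrightarrow> z \<in> carrier G \<Longrightarrow> commutator G z x \<in> T"
proof -
  interpret T: normal T G by fact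
  show "T \<subseteq> carrier G" "\<one> \<in> T" "x \<in> T \<Longrightarrow> inv x \<in> T" "x \<in> T \<Longrightarrow> y \<in> T \<Longrightarrow> x \<otimes> y \<in> T"
    "x \<in> T \<Longrightarrow> z \<in> carrier G \<Longrightarrow> inv z \<otimes> x \<otimes> z \<in> T"
    "x \<in> T \<Longrightarrow> z \<in> carrier G \<Longrightarrow> z \<otimes> x \<otimes> inv z \<in> T"
    by (auto simp: T.subset T.inv_op_closed1 T.inv_op_closed2)
  show *: "commutator G x z \<in> T" if "x \<in> T" "z \<in> carrier G" for x z
    using that T.inv_op_closed1[of z x]
    by (simp add: commutator_def m_assoc T.m_closed)
  show "x \<in> T \<Longrightarrow> z \<in> carrier G \<Longrightarrow> commutator G z x \<in> T"
    using * by (metis T.mem_carrier T.m_inv_closed inv_commutator)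
qed

lemma normal_subset_normal: "T \<lhd> G \<Longrightarrow> normal_subset T G"
  by (simp add: normal_subset_def normal_closed)

lemma nat_pow_mem_subgroup: "subgroup H G \<Longrightarrow> x \<in> H \<Longrightarrow> x [^] (n::nat) \<in> H"
  by (induct n) (auto simp: subgroup.one_closed subgroup.m_closed)

lemma normal_generate:
  assumes "normal_subset S G"
  shows "generate G S \<lhd> G"
proof (rule normal_generateI)
  show "S \<subseteq> carrier G"
    using assms by (simp add: normal_subset_def)
  fix h g assume "h \<in> S" "g \<in> carrier G"
  moreover have "inv (inv g) \<otimes> h \<otimes> inv g \<in> S" if "h \<in> S" "g \<in> carrier G"
    using assms that inv_closed unfolding normal_subset_def by blast
  ultimately show "g \<otimes> h \<otimes> inv g \<in> S"
    by simp
qed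

section \<open>Commutator subgroups and centralizers modulo a normal subgroup\<close>

definition comm_sub :: "'a set \<Rightarrow> 'a set \<Rightarrow> 'a set"
  where "comm_sub A B = generate G {commutator G a b |a b. a \<in> A \<and> b \<in> B}"

text \<open>For normal \<open>T\<close> this is the preimage of the centralizer of the image of
  \<open>B\<close> in \<open>G / T\<close>; for \<open>T = {\<one>}\<close> it is the ordinary
  centralizer of \<open>B\<close>.\<close>

definition colon :: "'a set \<Rightarrow> 'a set \<Rightarrow> 'a set"
  where "colon T B = {g \<in> carrier G. \<forall>b\<in>B. commutator G g b \<in> T}"

lemma commutator_mem_comm_sub: "a \<in> A \<Longrightarrow> b \<in> B \<Longrightarrow> commutator G a b \<in> comm_sub A B"
  by (auto simp: comm_sub_def intro!: generate.incl)

lemma colon_normal: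
  assumes "T \<lhd> G" "normal_subset B G"
  shows "colon T B \<lhd> G"
proof -
  note T = normal_closed[OF assms(1)]
  have B: "B \<subseteq> carrier G" "\<And>b g. b \<in> B \<Longrightarrow> g \<in> carrier G \<Longrightarrow> inv g \<otimes> b \<otimes> g \<in> B"
    using assms(2) by (auto simp: normal_subset_def)
  have "subgroup (colon T B) G"
  proof (rule subgroupI)
    show "colon T B \<subseteq> carrier G" "colon T B \<noteq> {}"
      using B T by (auto simp: colon_def intro!: exI[of _ \<one>])
    fix x y assume x: "x \<in> colon T B" and y: "y \<in> colon T B"
    show "inv x \<in> colon T B"
      using x T B by (auto simp: colon_def commutator_inv_left)
    show "x \<otimes> y \<in> colon T B"
      using x y T B by (auto simp: colon_def commutator_mult_left subset_iff)
  qed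
  moreover have "g \<otimes> x \<otimes> inv g \<in> colon T B" if x: "x \<in> colon T B" and g: "g \<in> carrier G" for x g
  proof -
    have "commutator G (g \<otimes> x \<otimes> inv g) b \<in> T" if b: "b \<in> B" for b
    proof -
      have bc: "b \<in> carrier G"
        using b B by auto
      have "commutator G x (inv g \<otimes> b \<otimes> g) \<in> T"
        using x B(2)[OF b g] by (simp add: colon_def)
      then have "g \<otimes> commutator G x (inv g \<otimes> b \<otimes> g) \<otimes> inv g \<in> T"
        using g by (rule T(6))
      also have "g \<otimes> commutator G x (inv g \<otimes> b \<otimes> g) \<otimes> inv g = commutator G (g \<otimes> x \<otimes> inv g) b"
        using conj_commutator[of x "inv g \<otimes> b \<otimes> g" "inv g"] x g bc
        by (simp add: colon_def m_assoc)
      finally show ?thesis .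
    qed
    then show ?thesis
      using x g by (simp add: colon_def)
  qed
  ultimately show ?thesis
    by (auto simp: normal_inv_iff)
qed

lemma colon_sym:
  assumes "T \<lhd> G" "A \<subseteq> carrier G" "B \<subseteq> carrier G"
  shows "A \<subseteq> colon T B \<longleftrightarrow> B \<subseteq> colon T A"
proof -
  have "commutator G a b \<in> T \<longleftrightarrow> commutator G b a \<in> T" if "a \<in> A" "b \<in> B" for a b
    using that assms normal_closed(3)[OF assms(1)] inv_commutator by (metis subsetD)
  then show ?thesis
    using assms by (auto simp: colon_def subset_iff)
qed

lemma colon_mono: "T \<subseteq> T' \<Longrightarrow> B' \<subseteq> B \<Longrightarrow> colon T B \<subseteq> colon T' B'"
  by (auto simp: colon_def)

lemma subset_colon: "T \<lhd> G \<Longrightarrow> B \<subseteq> carrier G \<Longrightarrow> T \<subseteq> colon T B"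
  by (auto simp: colon_def normal_closed dest: normal_closed(1))

lemma comm_sub_subset_iff:
  assumes "T \<lhd> G" "A \<subseteq> carrier G" "B \<subseteq> carrier G"
  shows "comm_sub A B \<subseteq> T \<longleftrightarrow> A \<subseteq> colon T B"
proof
  assume "comm_sub A B \<subseteq> T"
  then show "A \<subseteq> colon T B"
    using assms by (auto simp: comm_sub_def colon_def intro!: generate.incl)
next
  assume "A \<subseteq> colon T B"
  then show "comm_sub A B \<subseteq> T"
    unfolding comm_sub_def using assms
    by (intro generate_subgroup_incl normal_imp_subgroup) (auto simp: colon_def)
qed

lemma normal_subset_commutators:
  assumes "normal_subset X G" "normal_subset Y G"
  shows "normal_subset {commutator G x y |x y. x \<in> X \<and> y \<in> Y} G"
  using assms unfolding normal_subset_def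
  by (auto simp: subset_iff conj_commutator) blast

lemma comm_sub_normal:
  "normal_subset A G \<Longrightarrow> normal_subset B G \<Longrightarrow> comm_sub A B \<lhd> G"
  unfolding comm_sub_def by (intro normal_generate normal_subset_commutators)

lemma comm_sub_mono: "A \<subseteq> A' \<Longrightarrow> B \<subseteq> B' \<Longrightarrow> comm_sub A B \<subseteq> comm_sub A' B'"
  unfolding comm_sub_def by (rule mono_generate) blast

lemma comm_sub_commute:
  assumes "A \<lhd> G" "B \<lhd> G"
  shows "comm_sub A B = comm_sub B A"
proof -
  have *: "comm_sub A B \<subseteq> comm_sub B A" if "A \<lhd> G" "B \<lhd> G" for A B
  proof -
    have "comm_sub B A \<lhd> G"
      using that by (simp add: comm_sub_normal normal_subset_normal)
    then show ?thesis
      using that by (simp add: comm_sub_subset_iff colon_sym[of _ A B] normal_closed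
        flip: comm_sub_subset_iff[of _ B A])
  qed
  show ?thesis
    using assms by (intro equalityI *)
qed

lemma comm_sub_subset:
  assumes "A \<lhd> G" "B \<lhd> G"
  shows "comm_sub A B \<subseteq> A" "comm_sub A B \<subseteq> B"
  using normal_closed(1,7,8)[OF assms(1)] normal_closed(1,7,8)[OF assms(2)]
  by (auto simp: comm_sub_subset_iff[OF assms(1)] comm_sub_subset_iff[OF assms(2)] colon_def)

text \<open>As \<open>X\<close> and \<open>Y\<close> are normal sets,
  \<open>T = comm_sub X Y\<close> is normal and every \<open>colon\<close> over it is a subgroup. So
  \<open>X \<subseteq> colon T Y\<close> passes to the subgroup generated by \<open>X\<close>; the
  symmetry of \<open>colon\<close> then exchanges the roles, and \<open>Y\<close> is enlarged in the
  same way.\<close>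

lemma comm_sub_generate:
  assumes "normal_subset X G" "normal_subset Y G"
  shows "comm_sub (generate G X) (generate G Y) = comm_sub X Y"
proof
  let ?T = "comm_sub X Y"
  have T: "?T \<lhd> G" and XY: "X \<subseteq> carrier G" "Y \<subseteq> carrier G"
    using assms by (auto simp: comm_sub_normal normal_subset_def)
  note XY' = XY[THEN generate_incl]
  have "X \<subseteq> colon ?T Y"
    using T XY comm_sub_subset_iff by blast
  then have "generate G X \<subseteq> colon ?T Y"
    using T assms by (intro generate_subgroup_incl normal_imp_subgroup[OF colon_normal])
  then have "Y \<subseteq> colon ?T (generate G X)"
    using T XY XY' colon_sym by blast
  then have "generate G Y \<subseteq> colon ?T (generate G X)"
    using T assms by (intro generate_subgroup_incl normal_imp_subgroup[OF colon_normal]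
      normal_subset_normal[OF normal_generate])
  then have "generate G X \<subseteq> colon ?T (generate G Y)"
    using T XY' colon_sym by blast
  then show "comm_sub (generate G X) (generate G Y) \<subseteq> ?T"
    using T XY' comm_sub_subset_iff by blast
  show "?T \<subseteq> comm_sub (generate G X) (generate G Y)"
    by (rule comm_sub_mono) (auto intro: generate.incl)
qed

lemma three_subgroups:
  assumes T: "T \<lhd> G" and A: "A \<lhd> G" and B: "B \<lhd> G" and P: "P \<lhd> G"
    and 1: "comm_sub P A \<subseteq> colon T B" and 2: "comm_sub P B \<subseteq> colon T A"
  shows "comm_sub A B \<subseteq> colon T P"
proof -
  note c = A[THEN normal_closed(1)] B[THEN normal_closed(1)] P[THEN normal_closed(1)]
  have "commutator G a b \<in> colon T P" if ab: "a \<in> A" "b \<in> B" for a b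
  proof -
    have "commutator G (commutator G a b) p \<in> T" if p: "p \<in> P" for p
    proof -
      have abp: "a \<in> carrier G" "b \<in> carrier G" "p \<in> carrier G"
        using ab p c by auto
      have "commutator G (inv b) (inv p) \<in> comm_sub B P"
        unfolding comm_sub_def using ab p normal_closed(3)[OF B] normal_closed(3)[OF P]
        by (auto intro!: generate.incl)
      then have "commutator G (inv b) (inv p) \<in> colon T A"
        using 2 comm_sub_commute[OF B P] by auto
      then have u: "commutator G (commutator G (inv b) (inv p)) a \<in> T"
        using ab by (simp add: colon_def)
      have "commutator G p (inv a) \<in> comm_sub P A"
        unfolding comm_sub_def using ab p normal_closed(3)[OF A]
        by (auto intro!: generate.incl)
      then have v: "commutator G (commutator G p (inv a)) (inv b) \<in> T"
        using 1 ab normal_closed(3)[OF B] by (auto simp: colon_def)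
      \<comment> \<open>The factors of the Hall-Witt identity for \<open>a\<close>,
        \<open>inv b\<close>, \<open>p\<close>: two of them are conjugates of elements of
        \<open>T\<close>, hence the third, a conjugate of \<open>[[a, b], p]\<close>, lies in
        \<open>T\<close> as well.\<close>
      define w where "w = b \<otimes> commutator G (commutator G a b) p \<otimes> inv b"
      define u' where "u' = inv p \<otimes> commutator G (commutator G (inv b) (inv p)) a \<otimes> p"
      define v' where "v' = inv a \<otimes> commutator G (commutator G p (inv a)) (inv b) \<otimes> a"
      have uv: "u' \<in> T" "v' \<in> T"
        unfolding u'_def v'_def using u v abp normal_closed(5)[OF T] by auto
      have wc: "w \<in> carrier G"
        using abp by (simp add: w_def)
      have "w \<otimes> u' \<otimes> v' = \<one>"
        using Hall_Witt[of a "inv b" p] abp by (simp add: w_def u'_def v'_def)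
      then have "w = inv (u' \<otimes> v')"
        using wc uv[THEN subsetD[OF normal_closed(1)[OF T]]] m_assoc[of w u' v']
        by (intro inv_equality[symmetric]) auto
      then have "w \<in> T"
        using uv normal_closed(3,4)[OF T] by simp
      then have "inv b \<otimes> w \<otimes> b \<in> T"
        using abp normal_closed(5)[OF T] by simp
      then show ?thesis
        using abp by (simp add: w_def m_assoc)
    qed
    moreover have "commutator G a b \<in> carrier G"
      using ab c by (intro commutator_closed) auto
    ultimately show ?thesis
      by (simp add: colon_def)
  qed
  then show ?thesis
    unfolding comm_sub_def using T P
    by (intro generate_subgroup_incl normal_imp_subgroup colon_normal normal_subset_normal) auto
qed

end

section \<open>Iterated commutators along a tree\<close>

datatype ctree = Lf nat | Br ctree ctree

primrec leaves :: "ctree \<Rightarrow> nat set" where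
  "leaves (Lf i) = {i}"
| "leaves (Br a b) = leaves a \<union> leaves b"

text \<open>Distinct labels make the two branches of a node independent: their arguments can be
  chosen separately, and a change of one argument affects one branch only.\<close>

primrec distinct_leaves :: "ctree \<Rightarrow> bool" where
  "distinct_leaves (Lf i) \<longleftrightarrow> True"
| "distinct_leaves (Br a b) \<longleftrightarrow>
    distinct_leaves a \<and> distinct_leaves b \<and> leaves a \<inter> leaves b = {}"

lemma finite_leaves [simp]: "finite (leaves t)"
  by (induct t) auto

lemma leaves_nonempty [simp]: "leaves t \<noteq> {}"
  by (induct t) auto

context group
begin

primrec iter_comm :: "ctree \<Rightarrow> (nat \<Rightarrow> 'a set) \<Rightarrow> 'a set" where
  "iter_comm (Lf i) M = M i"
| "iter_comm (Br a b) M = comm_sub (iter_comm a M) (iter_comm b M)"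

primrec tree_word :: "ctree \<Rightarrow> (nat \<Rightarrow> 'a) \<Rightarrow> 'a" where
  "tree_word (Lf i) x = x i"
| "tree_word (Br a b) x = commutator G (tree_word a x) (tree_word b x)"

definition tree_values :: "ctree \<Rightarrow> (nat \<Rightarrow> 'a set) \<Rightarrow> 'a set"
  where "tree_values t X = {tree_word t x |x. \<forall>i\<in>leaves t. x i \<in> X i}"

lemma iter_comm_cong: "(\<And>i. i \<in> leaves t \<Longrightarrow> M i = M' i) \<Longrightarrow> iter_comm t M = iter_comm t M'"
  by (induct t) auto

lemma iter_comm_update [simp]: "j \<notin> leaves t \<Longrightarrow> iter_comm t (M(j := X)) = iter_comm t M"
  by (rule iter_comm_cong) auto

lemma tree_word_cong: "(\<And>i. i \<in> leaves t \<Longrightarrow> x i = y i) \<Longrightarrow> tree_word t x = tree_word t y"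
  by (induct t) auto

lemma tree_word_update [simp]: "j \<notin> leaves t \<Longrightarrow> tree_word t (x(j := g)) = tree_word t x"
  by (rule tree_word_cong) auto

lemma iter_comm_normal:
  "(\<And>i. M i \<lhd> G) \<Longrightarrow> iter_comm t M \<lhd> G"
  by (induct t) (auto simp: comm_sub_normal normal_subset_normal)

lemma iter_comm_mono:
  "(\<And>i. i \<in> leaves t \<Longrightarrow> M i \<subseteq> M' i) \<Longrightarrow> iter_comm t M \<subseteq> iter_comm t M'"
proof (induct t)
  case (Br a b)
  then show ?case
    using comm_sub_mono by simp
qed auto

lemma iter_comm_subset_leaf:
  "(\<And>i. M i \<lhd> G) \<Longrightarrow> i \<in> leaves t \<Longrightarrow> iter_comm t M \<subseteq> M i"
proof (induct t)
  case (Br a b)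
  then show ?case
    using comm_sub_subset[of "iter_comm a M" "iter_comm b M"] iter_comm_normal[of M] by auto
qed auto

lemma tree_values_Br:
  assumes "leaves a \<inter> leaves b = {}"
  shows "tree_values (Br a b) X =
    {commutator G u v |u v. u \<in> tree_values a X \<and> v \<in> tree_values b X}"
proof (intro equalityI subsetI)
  fix g assume "g \<in> {commutator G u v |u v. u \<in> tree_values a X \<and> v \<in> tree_values b X}"
  then obtain x y where xy: "\<forall>i\<in>leaves a. x i \<in> X i" "\<forall>i\<in>leaves b. y i \<in> X i"
    "g = commutator G (tree_word a x) (tree_word b y)"
    by (auto simp: tree_values_def)
  define z where "z i = (if i \<in> leaves a then x i else y i)" for i
  have "tree_word a z = tree_word a x" "tree_word b z = tree_word b y"
    using assms by (auto simp: z_def intro!: tree_word_cong)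
  then show "g \<in> tree_values (Br a b) X"
    using xy unfolding tree_values_def by (auto simp: z_def intro!: exI[of _ z])
qed (auto simp: tree_values_def)

lemma tree_values_normal:
  "distinct_leaves t \<Longrightarrow> (\<And>i. normal_subset (X i) G) \<Longrightarrow> normal_subset (tree_values t X) G"
proof (induct t)
  case (Lf i)
  have "tree_values (Lf i) X = X i"
    by (auto simp: tree_values_def intro: exI[of _ "\<lambda>_. _"])
  then show ?case
    using Lf by simp
qed (simp add: tree_values_Br normal_subset_commutators)

text \<open>This allows containment of an iterated commutator subgroup in another subgroup to be
  tested on word values, with any normal generating set chosen at each leaf.\<close>

lemma iter_comm_generate:
  assumes "distinct_leaves t" "\<And>i. normal_subset (X i) G"
  shows "iter_comm t (\<lambda>i. generate G (X i)) = generate G (tree_values t X)"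
  using assms(1)
proof (induct t)
  case (Lf i)
  have "tree_values (Lf i) X = X i"
    by (auto simp: tree_values_def intro: exI[of _ "\<lambda>_. _"])
  then show ?case
    by simp
next
  case (Br a b)
  then show ?case
    using assms by (simp add: comm_sub_generate tree_values_normal)
      (simp add: comm_sub_def tree_values_Br)
qed

lemma tree_word_mem:
  assumes "\<And>i. M i \<lhd> G" "\<forall>i\<in>leaves t. x i \<in> M i"
  shows "tree_word t x \<in> iter_comm t M"
  using assms(2)
proof (induct t)
  case (Br a b)
  then show ?case
    by (auto simp: comm_sub_def intro!: generate.incl)
qed auto

lemma iter_comm_Br_left:
  assumes "distinct_leaves (Br a b)" "\<And>i. M i \<lhd> G" "X \<lhd> G" "T \<lhd> G" "j \<in> leaves a"
  shows "iter_comm (Br a b) (M(j := X)) \<subseteq> T \<longleftrightarrow> iter_comm a (M(j := X)) \<subseteq> colon T (iter_comm b M)"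
proof -
  have "j \<notin> leaves b"
    using assms by auto
  moreover have "iter_comm s (M(j := X)) \<lhd> G" "iter_comm s M \<lhd> G" for s
    using assms by (auto intro!: iter_comm_normal)
  ultimately show ?thesis
    using assms(4) by (simp add: comm_sub_subset_iff normal_closed(1) del: fun_upd_apply)
qed

lemma iter_comm_Br_right:
  assumes "distinct_leaves (Br a b)" "\<And>i. M i \<lhd> G" "X \<lhd> G" "T \<lhd> G" "j \<in> leaves b"
  shows "iter_comm (Br a b) (M(j := X)) \<subseteq> T \<longleftrightarrow> iter_comm b (M(j := X)) \<subseteq> colon T (iter_comm a M)"
proof -
  have "iter_comm (Br a b) (M(j := X)) = iter_comm (Br b a) (M(j := X))"
    using assms by (simp add: comm_sub_commute iter_comm_normal del: fun_upd_apply)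
      (simp add: comm_sub_commute iter_comm_normal)
  then show ?thesis
    using assms iter_comm_Br_left[of b a M X T j] by (auto simp del: iter_comm.simps)
qed

text \<open>
  Commuting with \<open>P\<close> acts like a derivation on iterated commutator subgroups.
\<close>

lemma iter_comm_Leibniz:
  assumes "distinct_leaves t" "\<And>i. M i \<lhd> G" "T \<lhd> G" "P \<lhd> G"
    and "\<And>j. j \<in> leaves t \<Longrightarrow> iter_comm t (M(j := comm_sub P (M j))) \<subseteq> T"
  shows "comm_sub P (iter_comm t M) \<subseteq> T"
  using assms(1,3,5)
proof (induct t arbitrary: T)
  case (Lf i)
  then show ?case by simp
next
  case (Br a b)
  let ?A = "iter_comm a M" and ?B = "iter_comm b M"
  have AB: "?A \<lhd> G" "?B \<lhd> G"
    using assms(2) by (auto intro: iter_comm_normal)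
  have X: "comm_sub P (M j) \<lhd> G" for j
    using assms(2,4) by (simp add: comm_sub_normal normal_subset_normal)
  have col: "colon T ?A \<lhd> G" "colon T ?B \<lhd> G"
    using Br AB by (auto intro: colon_normal normal_subset_normal)
  have "comm_sub P ?A \<subseteq> colon T ?B"
  proof (rule Br.hyps)
    fix j assume "j \<in> leaves a"
    then show "iter_comm a (M(j := comm_sub P (M j))) \<subseteq> colon T ?B"
      using Br.prems(3)[of j] iter_comm_Br_left[of a b M _ T j, OF Br.prems(1) assms(2) X Br.prems(2)]
      by (simp del: iter_comm.simps fun_upd_apply)
  qed (use Br.prems col in auto)
  moreover have "comm_sub P ?B \<subseteq> colon T ?A"
  proof (rule Br.hyps)
    fix j assume "j \<in> leaves b"
    then show "iter_comm b (M(j := comm_sub P (M j))) \<subseteq> colon T ?A"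
      using Br.prems(3)[of j] iter_comm_Br_right[of a b M _ T j, OF Br.prems(1) assms(2) X Br.prems(2)]
      by (simp del: iter_comm.simps fun_upd_apply)
  qed (use Br.prems col in auto)
  ultimately have "comm_sub ?A ?B \<subseteq> colon T P"
    using three_subgroups Br.prems(2) AB assms(4) by blast
  moreover have "comm_sub ?A ?B \<lhd> G"
    using AB by (simp add: comm_sub_normal normal_subset_normal)
  ultimately show ?case
    using Br.prems(2) assms(4) comm_sub_subset_iff comm_sub_commute normal_closed(1)
    by (metis iter_comm.simps(2))
qed

text \<open>Modulo \<open>T\<close> the commutators of \<open>A\<close> with \<open>B\<close> are
  centralized by \<open>A\<close>, so \<open>[x y, v] = y^-1 [x, v] y [y, v]\<close> makes
  \<open>x \<mapsto> [x, v]\<close> a homomorphism on \<open>A\<close> modulo \<open>T\<close>. The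
  factor \<open>z\<close>, which it sends into \<open>T\<close>, stands for the error that arises
  further down in a tree.\<close>

lemma commutator_pow_left:
  assumes T: "T \<lhd> G" and A: "A \<lhd> G" and B: "B \<lhd> G"
    and L: "comm_sub (comm_sub A B) A \<subseteq> T"
    and u: "u \<in> A" and v: "v \<in> B" and z: "z \<in> A" "z \<in> colon T B"
  shows "\<exists>t\<in>T. commutator G (u [^] (p::nat) \<otimes> z) v = commutator G u v [^] p \<otimes> t"
proof -
  note c = A[THEN normal_closed(1), THEN subsetD] B[THEN normal_closed(1), THEN subsetD]
    T[THEN normal_closed(1), THEN subsetD]
  have uc: "u \<in> carrier G" "v \<in> carrier G" "z \<in> carrier G"
    using u v z c by auto
  have pw: "u [^] n \<in> A" for n :: nat
    using A u by (meson normal_imp_subgroup nat_pow_mem_subgroup)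
  have L': "commutator G (commutator G a v) b \<in> T" if "a \<in> A" "b \<in> A" for a b
    by (intro subsetD[OF L] commutator_mem_comm_sub v that)
  have step: "inv b \<otimes> commutator G a v \<otimes> b =
      commutator G a v \<otimes> commutator G (commutator G a v) b" if "a \<in> A" "b \<in> A" for a b
    using that c(1)[of a] c(1)[of b] uc by (simp add: commutator_def[of _ _ b] m_assoc)
  have 1: "\<exists>t\<in>T. commutator G (u [^] n) v = commutator G u v [^] n \<otimes> t" for n :: nat
  proof (induct n)
    case 0
    then show ?case
      using uc normal_closed(2)[OF T] by (auto intro!: bexI[of _ \<one>])
  next
    case (Suc n)
    then obtain t where t: "t \<in> T" "commutator G (u [^] n) v = commutator G u v [^] n \<otimes> t"
      by blast
    define s where "s = commutator G (commutator G (u [^] n) v) u"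
    have s: "s \<in> T"
      unfolding s_def using pw u by (rule L')
    define cc where "cc = commutator G u v"
    have cc: "cc \<in> carrier G"
      using uc by (simp add: cc_def)
    have "commutator G (u [^] Suc n) v = cc [^] n \<otimes> t \<otimes> s \<otimes> cc"
      using uc step[OF pw u, of n] t by (simp add: commutator_mult_left s_def cc_def)
    also have "\<dots> = cc [^] Suc n \<otimes> (inv cc \<otimes> (t \<otimes> s) \<otimes> cc)"
      using cc s t c by (simp add: m_assoc)
    finally show ?case
      using s t cc normal_closed(4,5)[OF T] by (auto simp: cc_def[symmetric])
  qed
  obtain t where t: "t \<in> T" "commutator G (u [^] p) v = commutator G u v [^] p \<otimes> t"
    using 1 by blast
  have s: "commutator G (commutator G (u [^] p) v) z \<in> T" "commutator G z v \<in> T"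
    using L'[OF pw z(1)] z v by (auto simp: colon_def)
  have "commutator G (u [^] p \<otimes> z) v =
      commutator G u v [^] p \<otimes> (t \<otimes> commutator G (commutator G (u [^] p) v) z \<otimes> commutator G z v)"
    using uc step[OF pw z(1), of p] t c s by (simp add: commutator_mult_left m_assoc)
  then show ?thesis
    using t s normal_closed(4)[OF T] by blast
qed

text \<open>
  A sufficient condition for \<open>tree_word t\<close>, evaluated on \<open>M\<close> modulo \<open>T\<close>, to be compatible with
  taking powers of the argument with index \<open>i\<close>.
\<close>

primrec power_linear :: "(nat \<Rightarrow> 'a set) \<Rightarrow> ctree \<Rightarrow> 'a set \<Rightarrow> nat \<Rightarrow> bool" where
  "power_linear M (Lf j) T i \<longleftrightarrow> True"
| "power_linear M (Br a b) T i \<longleftrightarrow>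
    (i \<in> leaves a \<longrightarrow> comm_sub (iter_comm (Br a b) M) (iter_comm a M) \<subseteq> T \<and>
      power_linear M a (colon T (iter_comm b M)) i) \<and>
    (i \<in> leaves b \<longrightarrow> comm_sub (iter_comm (Br a b) M) (iter_comm b M) \<subseteq> T \<and>
      power_linear M b (colon T (iter_comm a M)) i)"

lemma tree_word_pow:
  assumes "distinct_leaves t" "\<And>j. M j \<lhd> G" "T \<lhd> G" "i \<in> leaves t"
    "\<forall>j\<in>leaves t. x j \<in> M j" "power_linear M t T i"
  shows "\<exists>z\<in>T. tree_word t (x(i := x i [^] (p::nat))) = tree_word t x [^] p \<otimes> z"
  using assms(1,3-)
proof (induct t arbitrary: T)
  case (Lf j)
  then show ?case
    using normal_closed(1)[OF assms(2)] normal_closed(2)[of T]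
    by (auto intro!: bexI[of _ \<one>] simp: subset_iff)
next
  case (Br a b)
  let ?A = "iter_comm a M" and ?B = "iter_comm b M"
  let ?u = "tree_word a x" and ?v = "tree_word b x"
  let ?x = "x(i := x i [^] p)"
  have AB: "?A \<lhd> G" "?B \<lhd> G"
    using assms(2) by (auto intro: iter_comm_normal)
  note c = normal_closed(1)[OF AB(1), THEN subsetD] normal_closed(1)[OF AB(2), THEN subsetD]
    normal_closed(1)[OF Br.prems(2), THEN subsetD]
  have uv: "?u \<in> ?A" "?v \<in> ?B"
    using Br.prems(4) by (auto intro: tree_word_mem assms)
  have x: "\<forall>j\<in>leaves t. ?x j \<in> M j" if "leaves t \<subseteq> leaves (Br a b)" for t
    using that Br.prems(4) assms(2)[of i, THEN normal_imp_subgroup] nat_pow_mem_subgroup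
    by auto
  have col: "colon T ?A \<lhd> G" "colon T ?B \<lhd> G"
    using Br AB by (auto intro: colon_normal normal_subset_normal)
  \<comment> \<open>The induction hypothesis places the error \<open>z\<close> only in a
    \<open>colon\<close>; it also lies in the subgroup of the child, being a quotient of two
    elements of that subgroup.\<close>
  have rest: "z \<in> A" if "w [^] p \<otimes> z \<in> A" "w \<in> A" "A \<lhd> G" "z \<in> carrier G" for w z A
  proof -
    have "w [^] p \<in> A"
      using that by (meson normal_imp_subgroup nat_pow_mem_subgroup)
    then have "inv (w [^] p) \<otimes> (w [^] p \<otimes> z) \<in> A"
      using that normal_closed(3,4) by blast
    then show ?thesis
      using that normal_closed(1)[OF that(3)] by auto
  qed
  show ?case
  proof (cases "i \<in> leaves a")
    case True
    then have ib: "i \<notin> leaves b"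
      using Br.prems(1) by auto
    have "\<exists>z\<in>colon T ?B. tree_word a ?x = ?u [^] p \<otimes> z"
      using Br True col by (intro Br.hyps) auto
    then obtain z where z: "z \<in> colon T ?B" "tree_word a ?x = ?u [^] p \<otimes> z"
      by blast
    have "tree_word a ?x \<in> ?A"
      by (intro tree_word_mem assms x) auto
    then have "z \<in> ?A"
      using rest[of ?u z ?A] uv AB z by (auto simp: colon_def)
    then show ?thesis
      using commutator_pow_left[of T ?A ?B ?u ?v z p] Br.prems True AB uv z ib
      by (simp del: fun_upd_apply)
  next
    case False
    then have ib: "i \<in> leaves b"
      using Br.prems(3) by auto
    have "\<exists>z\<in>colon T ?A. tree_word b ?x = ?v [^] p \<otimes> z"
      using Br ib col by (intro Br.hyps) auto
    then obtain z where z: "z \<in> colon T ?A" "tree_word b ?x = ?v [^] p \<otimes> z"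
      by blast
    have "tree_word b ?x \<in> ?B"
      by (intro tree_word_mem assms x) auto
    then have zB: "z \<in> ?B"
      using rest[of ?v z ?B] uv AB z by (auto simp: colon_def)
    have "comm_sub (comm_sub ?B ?A) ?B \<subseteq> T"
      using Br.prems(5) ib AB comm_sub_commute by simp
    then obtain t where t: "t \<in> T"
      "commutator G (?v [^] p \<otimes> z) ?u = commutator G ?v ?u [^] p \<otimes> t"
      using commutator_pow_left[of T ?B ?A ?v ?u z p] Br.prems AB uv z zB by auto
    define k where "k = commutator G ?u ?v"
    have k: "k \<in> carrier G" "inv k = commutator G ?v ?u"
      using uv c by (auto simp: k_def inv_commutator)
    \<comment> \<open>The right argument is reduced to the left one by inverting the
      commutator.\<close>
    have "tree_word (Br a b) ?x = inv (commutator G (?v [^] p \<otimes> z) ?u)"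
      using uv c z zB False by (simp add: inv_commutator)
    also have "\<dots> = inv (inv k [^] p \<otimes> t)"
      using t k by simp
    also have "\<dots> = k [^] p \<otimes> (inv (k [^] p) \<otimes> inv t \<otimes> k [^] p)"
      using k(1) t c by (simp add: inv_mult_group nat_pow_inv m_assoc)
    finally show ?thesis
      using t k(1) normal_closed(3,5)[OF Br.prems(2)] unfolding k_def tree_word.simps by blast
  qed
qed

end

section \<open>Three criteria for compatibility with powers\<close>

primrec subtrees :: "ctree \<Rightarrow> ctree set" where
  "subtrees (Lf i) = {Lf i}"
| "subtrees (Br a b) = insert (Br a b) (subtrees a \<union> subtrees b)"

lemma finite_subtrees [simp]: "finite (subtrees t)"
  by (induct t) auto

lemma subtrees_refl [simp]: "t \<in> subtrees t"
  by (cases t) auto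

lemma subtrees_trans: "u \<in> subtrees s \<Longrightarrow> s \<in> subtrees t \<Longrightarrow> u \<in> subtrees t"
  by (induct t) auto

lemma subtrees_leaves: "u \<in> subtrees t \<Longrightarrow> leaves u \<subseteq> leaves t"
  by (induct t) auto

lemma subtrees_distinct: "u \<in> subtrees t \<Longrightarrow> distinct_leaves t \<Longrightarrow> distinct_leaves u"
  by (induct t) auto

context group
begin

lemma iter_comm_subset_subtree:
  "(\<And>i. M i \<lhd> G) \<Longrightarrow> u \<in> subtrees t \<Longrightarrow> iter_comm t M \<subseteq> iter_comm u M"
proof (induct t)
  case (Br a b)
  then show ?case
    using comm_sub_subset[of "iter_comm a M" "iter_comm b M"] iter_comm_normal[of M] by auto
qed auto

text \<open>The subgroup of a subtree that contains the leaf \<open>i\<close> lies in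
  \<open>M i\<close>, hence in \<open>P\<close>, so every error term lies in \<open>[P, P]\<close>.
  The assumption on \<open>[P, P]\<close> survives the descent because
  \<open>T \<subseteq> colon T B\<close>.\<close>

lemma power_linear_abelian:
  assumes "\<And>j. M j \<lhd> G" "T \<lhd> G" "i \<in> leaves t" "M i \<subseteq> P" "comm_sub P P \<subseteq> T" "distinct_leaves t"
  shows "power_linear M t T i"
  using assms(2,3,5,6)
proof (induct t arbitrary: T)
  case (Br a b)
  have *: "comm_sub (comm_sub (iter_comm a M) (iter_comm b M)) (iter_comm s M) \<subseteq> T \<and>
      comm_sub P P \<subseteq> colon T (iter_comm s' M) \<and> colon T (iter_comm s' M) \<lhd> G"
    if "i \<in> leaves s" "s \<in> {a, b}" for s s'
  proof -
    have n: "iter_comm s M \<lhd> G" for s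
      using assms by (auto intro: iter_comm_normal)
    have "iter_comm s M \<subseteq> P"
      using iter_comm_subset_leaf[of M i s] assms that by auto
    moreover have "comm_sub (iter_comm a M) (iter_comm b M) \<subseteq> iter_comm s M"
      using comm_sub_subset[of "iter_comm a M" "iter_comm b M"] n that by auto
    ultimately have "comm_sub (comm_sub (iter_comm a M) (iter_comm b M)) (iter_comm s M) \<subseteq> comm_sub P P"
      by (intro comm_sub_mono) auto
    then show ?thesis
      using Br.prems n[of s'] subset_colon[of T "iter_comm s' M"] normal_closed(1)
      by (auto simp: colon_normal normal_subset_normal)
  qed
  show ?case
    using *[of a b] *[of b a] Br by auto
qed auto

text \<open>The subgroup of a subtree that contains \<open>i\<close> lies in \<open>P\<close>, so
  the error terms are commutators with \<open>P\<close>; by the derivation property these are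
  controlled by changing one leaf at a time. The assumption passes to a child with a
  \<open>colon\<close> as new target.\<close>

lemma power_linear_Leibniz:
  assumes "\<And>j. M j \<lhd> G" "T \<lhd> G" "P \<lhd> G" "i \<in> leaves t" "M i \<subseteq> P" "distinct_leaves t"
    and "\<And>j. j \<in> leaves t \<Longrightarrow> iter_comm t (M(j := comm_sub P (M j))) \<subseteq> T"
  shows "power_linear M t T i"
  using assms(2,4,6,7)
proof (induct t arbitrary: T)
  case (Br a b)
  let ?t = "Br a b"
  have n: "iter_comm s M \<lhd> G" for s
    using assms by (auto intro: iter_comm_normal)
  have X: "comm_sub P (M j) \<lhd> G" for j
    using assms by (simp add: comm_sub_normal normal_subset_normal)
  have "comm_sub P (iter_comm ?t M) \<subseteq> T"
    by (rule iter_comm_Leibniz[OF Br.prems(3) assms(1) Br.prems(1) assms(3) Br.prems(4)])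
  then have PT: "comm_sub (iter_comm ?t M) P \<subseteq> T"
    using comm_sub_commute[OF assms(3) n, of ?t] by simp
  have *: "comm_sub (iter_comm ?t M) (iter_comm s M) \<subseteq> T" if "i \<in> leaves s" for s
    using comm_sub_mono[OF subset_refl, of "iter_comm s M" P "iter_comm ?t M"]
      iter_comm_subset_leaf[of M i s] assms that PT by blast
  have col: "colon T (iter_comm s M) \<lhd> G" for s
    using Br.prems(1) n by (auto intro: colon_normal normal_subset_normal)
  have "iter_comm a (M(j := comm_sub P (M j))) \<subseteq> colon T (iter_comm b M)" if "j \<in> leaves a" for j
    using that Br.prems(4)[of j] iter_comm_Br_left[of a b M _ T j, OF Br.prems(3) assms(1) X Br.prems(1)]
    by (simp del: iter_comm.simps fun_upd_apply)
  moreover have "iter_comm b (M(j := comm_sub P (M j))) \<subseteq> colon T (iter_comm a M)" if "j \<in> leaves b" for j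
    using that Br.prems(4)[of j] iter_comm_Br_right[of a b M _ T j, OF Br.prems(3) assms(1) X Br.prems(1)]
    by (simp del: iter_comm.simps fun_upd_apply)
  ultimately show ?case
    using Br.hyps Br.prems col * by (simp del: iter_comm.simps fun_upd_apply)
qed auto

lemma comm_sub_subset_Int: "A \<lhd> G \<Longrightarrow> B \<lhd> G \<Longrightarrow> comm_sub A B \<subseteq> B \<inter> A"
  using comm_sub_subset by auto

lemma iter_comm_Leibniz_Int:
  assumes "distinct_leaves t" "\<And>i. M i \<lhd> G" "T \<lhd> G" "P \<lhd> G"
    and "\<And>j. j \<in> leaves t \<Longrightarrow> iter_comm t (M(j := M j \<inter> P)) \<subseteq> T"
  shows "comm_sub P (iter_comm t M) \<subseteq> T"
proof (rule iter_comm_Leibniz)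
  fix j assume j: "j \<in> leaves t"
  have "iter_comm t (M(j := comm_sub P (M j))) \<subseteq> iter_comm t (M(j := M j \<inter> P))"
    using comm_sub_subset_Int assms by (intro iter_comm_mono) auto
  then show "iter_comm t (M(j := comm_sub P (M j))) \<subseteq> T"
    using assms(5)[OF j] by blast
qed (use assms in auto)

text \<open>The path from the root to \<open>i\<close> runs through \<open>v\<close> into its child
  \<open>u\<close>; let \<open>D = iter_comm b N\<close> belong to the sibling \<open>b\<close>. At
  a node above \<open>v\<close> the child on the path has its subgroup inside
  \<open>P \<inter> D\<close>, since it contains \<open>b\<close>, and the terms with
  \<open>P \<inter> D\<close> control the error. At \<open>v\<close> the error lies in
  \<open>[[P, D], iter_comm u N]\<close>, which is controlled by the terms with \<open>P\<close> at
  a leaf of \<open>b\<close>. Inside \<open>u\<close>, the inclusion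
  \<open>P \<subseteq> iter_comm u N\<close> turns this into
  \<open>[[D, P], P] \<subseteq> T\<close>, and three subgroups give
  \<open>[[P, P], D] \<subseteq> T\<close>: the situation of the abelian criterion.\<close>

lemma power_linear_sibling:
  assumes N: "\<And>j. N j \<lhd> G" and P: "P \<lhd> G" and T: "T \<lhd> G" and "distinct_leaves s"
    and "v \<in> subtrees s" and v: "v = Br u b \<or> v = Br b u"
    and i: "i \<in> leaves u" and Pu: "P \<subseteq> iter_comm u N"
    and "\<And>j. j \<in> leaves s \<Longrightarrow> iter_comm s (N(j := N j \<inter> (P \<inter> iter_comm b N))) \<subseteq> T"
    and "\<And>j. j \<in> leaves b \<Longrightarrow> iter_comm s (N(j := N j \<inter> P)) \<subseteq> T"
  shows "power_linear (N(i := N i \<inter> P)) s T i"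
  using assms(3-5,9,10)
proof (induct s arbitrary: T)
  case (Br c d)
  let ?M = "N(i := N i \<inter> P)" and ?s = "Br c d"
  let ?Q = "P \<inter> iter_comm b N"
  have nN: "iter_comm s N \<lhd> G" for s
    using N by (auto intro: iter_comm_normal)
  have M: "?M j \<lhd> G" for j
    using N P by (auto intro: normal_subgroup_intersect)
  then have nM: "iter_comm s ?M \<lhd> G" for s
    by (auto intro: iter_comm_normal)
  have NP: "N j \<inter> P \<lhd> G" for j
    using N P by (auto intro: normal_subgroup_intersect)
  have Q: "?Q \<lhd> G" "N j \<inter> ?Q \<lhd> G" for j
    using N P nN by (auto intro!: normal_subgroup_intersect)
  have MN: "iter_comm s ?M \<subseteq> iter_comm s N" for s
    by (intro iter_comm_mono) auto
  have MP: "iter_comm s ?M \<subseteq> P" if "i \<in> leaves s" for s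
    using iter_comm_subset_leaf[of ?M i s] M that by auto
  have col: "colon T (iter_comm s N) \<lhd> G" for s
    using Br.prems(1) nN by (auto intro: colon_normal normal_subset_normal)
  have ib: "i \<notin> leaves b"
    using subtrees_distinct[OF Br.prems(3,2)] v i by auto
  have dc: "distinct_leaves c" "distinct_leaves d" "leaves c \<inter> leaves d = {}"
    using Br.prems by auto
  show ?case
  proof (cases "v = ?s")
    case True
    then have cd: "c = u \<and> d = b \<or> c = b \<and> d = u"
      using v by auto
    have PB: "comm_sub P (iter_comm b N) \<subseteq> colon T (iter_comm u N)"
    proof (rule iter_comm_Leibniz_Int)
      fix j assume j: "j \<in> leaves b"
      then show "iter_comm b (N(j := N j \<inter> P)) \<subseteq> colon T (iter_comm u N)"
        using cd Br.prems(5)[OF j] iter_comm_Br_left[of c d N "N j \<inter> P" T j, OF Br.prems(2) N NP Br.prems(1)]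
          iter_comm_Br_right[of c d N "N j \<inter> P" T j, OF Br.prems(2) N NP Br.prems(1)]
        by (elim disjE) (simp_all del: iter_comm.simps fun_upd_apply)
    qed (use cd dc N P col in auto)
    then have 0: "comm_sub (comm_sub P (iter_comm b N)) (iter_comm u N) \<subseteq> T"
      using comm_sub_subset_iff[OF Br.prems(1), of "comm_sub P (iter_comm b N)" "iter_comm u N"]
        comm_sub_normal[of P "iter_comm b N"] P nN by (auto simp: normal_closed(1) normal_subset_normal)
    have "comm_sub (comm_sub (iter_comm u ?M) (iter_comm b ?M)) (iter_comm u ?M) \<subseteq>
        comm_sub (comm_sub P (iter_comm b N)) (iter_comm u N)"
      using MP i ib MN by (intro comm_sub_mono) auto
    then have 1: "comm_sub (comm_sub (iter_comm u ?M) (iter_comm b ?M)) (iter_comm u ?M) \<subseteq> T"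
      using 0 by blast
    have "comm_sub P P \<subseteq> colon T (iter_comm b N)"
    proof (rule three_subgroups)
      show "comm_sub (iter_comm b N) P \<subseteq> colon T P" "comm_sub (iter_comm b N) P \<subseteq> colon T P"
        using PB comm_sub_commute[OF P nN, of b] colon_mono[OF subset_refl Pu, of T] by auto
    qed (use Br.prems nN P in auto)
    then have 2: "power_linear ?M u (colon T (iter_comm b N)) i"
      using M col i cd dc by (intro power_linear_abelian) auto
    have "comm_sub (iter_comm u ?M) (iter_comm b ?M) = comm_sub (iter_comm b ?M) (iter_comm u ?M)"
      using nM by (intro comm_sub_commute) auto
    then show ?thesis
      using 1 2 cd i ib by (auto simp del: fun_upd_apply)
  next
    case False
    have "comm_sub ?Q (iter_comm ?s N) \<subseteq> T"
      by (rule iter_comm_Leibniz_Int[OF Br.prems(2) N Br.prems(1) Q(1) Br.prems(4)])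
    then have Qs: "comm_sub (iter_comm ?s N) ?Q \<subseteq> T"
      using comm_sub_commute[OF Q(1) nN, of ?s] by simp
    have *: "comm_sub (iter_comm ?s ?M) (iter_comm s ?M) \<subseteq> T" if vs: "v \<in> subtrees s" for s
    proof -
      have ls: "i \<in> leaves s"
        using subtrees_leaves[OF vs] v i by auto
      have "b \<in> subtrees v"
        using v by auto
      then have "iter_comm s ?M \<subseteq> iter_comm b ?M"
        using iter_comm_subset_subtree[of ?M b s] M subtrees_trans[of b v s] vs by blast
      then have "iter_comm s ?M \<subseteq> ?Q"
        using ib MP[OF ls] by (simp del: fun_upd_apply)
      then have "comm_sub (iter_comm ?s ?M) (iter_comm s ?M) \<subseteq> comm_sub (iter_comm ?s N) ?Q"
        by (intro comm_sub_mono MN)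
      then show ?thesis
        using Qs by blast
    qed
    consider "v \<in> subtrees c" | "v \<in> subtrees d"
      using Br.prems(3) False by auto
    then show ?thesis
    proof cases
      case 1
      then have l: "i \<in> leaves c" "i \<notin> leaves d" "leaves b \<subseteq> leaves c"
        using subtrees_leaves[OF 1] v i dc by auto
      have "power_linear ?M c (colon T (iter_comm d N)) i"
      proof (rule Br.hyps)
        show "iter_comm c (N(j := N j \<inter> ?Q)) \<subseteq> colon T (iter_comm d N)" if "j \<in> leaves c" for j
          using that Br.prems(4)[of j]
            iter_comm_Br_left[of c d N "N j \<inter> ?Q" T j, OF Br.prems(2) N Q(2) Br.prems(1)]
          by (simp del: iter_comm.simps fun_upd_apply)
        show "iter_comm c (N(j := N j \<inter> P)) \<subseteq> colon T (iter_comm d N)" if "j \<in> leaves b" for j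
          using that l Br.prems(5)[of j]
            iter_comm_Br_left[of c d N "N j \<inter> P" T j, OF Br.prems(2) N NP Br.prems(1)]
          by (auto simp del: iter_comm.simps fun_upd_apply)
      qed (use dc col 1 in auto)
      then show ?thesis
        using *[OF 1] l by (simp del: fun_upd_apply)
    next
      case 2
      then have l: "i \<in> leaves d" "i \<notin> leaves c" "leaves b \<subseteq> leaves d"
        using subtrees_leaves[OF 2] v i dc by auto
      have "power_linear ?M d (colon T (iter_comm c N)) i"
      proof (rule Br.hyps)
        show "iter_comm d (N(j := N j \<inter> ?Q)) \<subseteq> colon T (iter_comm c N)" if "j \<in> leaves d" for j
          using that Br.prems(4)[of j]
            iter_comm_Br_right[of c d N "N j \<inter> ?Q" T j, OF Br.prems(2) N Q(2) Br.prems(1)]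
          by (simp del: iter_comm.simps fun_upd_apply)
        show "iter_comm d (N(j := N j \<inter> P)) \<subseteq> colon T (iter_comm c N)" if "j \<in> leaves b" for j
          using that l Br.prems(5)[of j]
            iter_comm_Br_right[of c d N "N j \<inter> P" T j, OF Br.prems(2) N NP Br.prems(1)]
          by (auto simp del: iter_comm.simps fun_upd_apply)
      qed (use dc col 2 in auto)
      then show ?thesis
        using *[OF 2] l by (simp del: fun_upd_apply)
    qed
  qed
qed (use v in auto)

end

section \<open>Torsion modulo the derived subgroup\<close>

context group
begin

lemma pow_mult_normal:
  assumes "T \<lhd> G" "a \<in> carrier G" "z \<in> T"
  shows "\<exists>z'\<in>T. (a \<otimes> z) [^] (q::nat) = a [^] q \<otimes> z'"
proof (induct q)
  case 0
  then show ?case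
    using normal_closed(2)[OF assms(1)] by (auto intro!: bexI[of _ \<one>])
next
  case (Suc q)
  then obtain z' where z': "z' \<in> T" "(a \<otimes> z) [^] q = a [^] q \<otimes> z'"
    by blast
  note c = normal_closed(1)[OF assms(1), THEN subsetD]
  have "(a \<otimes> z) [^] Suc q = a [^] Suc q \<otimes> (inv a \<otimes> z' \<otimes> a \<otimes> z)"
    using z' assms c by (simp add: m_assoc)
  then show ?case
    using z' assms normal_closed(4,5)[OF assms(1)] by blast
qed

lemma pow_mult_derived:
  assumes K: "K \<lhd> G" and uv: "u \<in> K" "v \<in> K"
  shows "\<exists>z\<in>comm_sub K K. (u \<otimes> v) [^] (q::nat) = u [^] q \<otimes> v [^] q \<otimes> z"
proof (induct q)
  have T: "comm_sub K K \<lhd> G"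
    using K by (simp add: comm_sub_normal normal_subset_normal)
  case 0
  show ?case
    using normal_closed(2)[OF T] by (auto intro!: bexI[of _ \<one>])
next
  have T: "comm_sub K K \<lhd> G"
    using K by (simp add: comm_sub_normal normal_subset_normal)
  case (Suc q)
  then obtain z where z: "z \<in> comm_sub K K" "(u \<otimes> v) [^] q = u [^] q \<otimes> v [^] q \<otimes> z"
    by blast
  note c = normal_closed(1)[OF T, THEN subsetD] normal_closed(1)[OF K, THEN subsetD]
  define w where "w = v [^] q"
  have w: "w \<in> K" "w \<in> carrier G"
    using uv K c by (auto simp: w_def nat_pow_mem_subgroup normal_imp_subgroup)
  have uvc: "u \<in> carrier G" "v \<in> carrier G" "z \<in> carrier G"
    using uv z c by auto
  have "(u \<otimes> v) [^] Suc q = u [^] q \<otimes> w \<otimes> z \<otimes> (u \<otimes> v)"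
    using z by (simp add: w_def)
  also have "\<dots> = u [^] Suc q \<otimes> v [^] Suc q \<otimes>
      (inv v \<otimes> commutator G w u \<otimes> v \<otimes> (inv (u \<otimes> v) \<otimes> z \<otimes> (u \<otimes> v)))"
    using uvc w by (simp add: w_def[symmetric] commutator_def m_assoc inv_mult_group)
  finally show ?case
    using uvc z w uv normal_closed(4,5)[OF T] commutator_mem_comm_sub[of w K u K] by blast
qed

lemma generate_subgroup_self: "subgroup H G \<Longrightarrow> generate G H = H"
  by (simp add: equalityI generate_subgroup_incl generate.incl subsetI)

end

text \<open>The conditions are imposed at all indices to avoid side conditions at the leaves; an
  index outside the tree can be given the whole group as \<open>S i\<close> and \<open>N i\<close>,
  with exponent 1.\<close>

locale power_generated_tree = group G for G :: "('a, 'b) monoid_scheme" (structure) +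
  fixes t :: ctree and S N :: "nat \<Rightarrow> 'a set" and n :: "nat \<Rightarrow> nat" and m :: nat
  assumes distinct_t: "distinct_leaves t"
    and S_normal: "\<And>i. normal_subset (S i) G"
    and N_eq: "\<And>i. N i = generate G (S i)"
    and S_pow: "\<And>i x. x \<in> N i \<Longrightarrow> x [^] n i \<in> S i"
    and finite_values: "finite (tree_values t S)"
    and card_values: "card (tree_values t S) \<le> m"
    and n_pos: "\<And>i. n i \<ge> 1"
begin

abbreviation K where "K \<equiv> iter_comm t N"

definition L where "L = card (leaves t)"

text \<open>The factorial is a multiple of every difference of two exponents found by the pigeonhole
  principle among \<open>0, ..., m\<close>. The product of the \<open>n i\<close> is an exponent
  that sends every argument into its \<open>S i\<close>; it is used once for each such argument, at
  most \<open>L\<close> times.\<close>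

definition e where "e = fact m * (\<Prod>i\<in>leaves t. n i) ^ L"

text \<open>The filtration counts applications of the pigeonhole argument: each of them costs one
  factor \<open>e\<close> in the exponent. Every level is a subgroup because \<open>K / K'\<close>
  is abelian.\<close>

definition torsion :: "nat \<Rightarrow> 'a set"
  where "torsion r = {v \<in> K. v [^] (e ^ r) \<in> comm_sub K K}"

lemma N_normal: "N i \<lhd> G"
  by (simp add: N_eq normal_generate S_normal)

lemma K_normal: "K \<lhd> G"
  by (rule iter_comm_normal) (rule N_normal)

lemma K'_normal: "comm_sub K K \<lhd> G"
  using K_normal by (simp add: comm_sub_normal normal_subset_normal)

lemma K_generate: "K = generate G (tree_values t S)"
proof -
  have "N = (\<lambda>i. generate G (S i))"
    by (simp add: fun_eq_iff N_eq)
  then show ?thesis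
    using iter_comm_generate[OF distinct_t, of S] S_normal by simp
qed

lemma torsion_normal: "torsion r \<lhd> G"
proof -
  note Kc = normal_closed[OF K_normal] and T = normal_closed[OF K'_normal]
  have "subgroup (torsion r) G"
  proof (rule subgroupI)
    show "torsion r \<subseteq> carrier G" "torsion r \<noteq> {}"
      using Kc T by (auto simp: torsion_def intro!: exI[of _ \<one>])
    fix x y assume x: "x \<in> torsion r" and y: "y \<in> torsion r"
    then show "inv x \<in> torsion r"
      using Kc T by (auto simp: torsion_def nat_pow_inv subset_iff)
    obtain z where "z \<in> comm_sub K K" "(x \<otimes> y) [^] (e^r) = x [^] (e^r) \<otimes> y [^] (e^r) \<otimes> z"
      using pow_mult_derived[OF K_normal, of x y "e^r"] x y by (auto simp: torsion_def)
    then show "x \<otimes> y \<in> torsion r"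
      using x y Kc T by (auto simp: torsion_def)
  qed
  moreover have "g \<otimes> x \<otimes> inv g \<in> torsion r" if x: "x \<in> torsion r" and g: "g \<in> carrier G" for x g
  proof -
    have xc: "x \<in> carrier G"
      using x Kc by (auto simp: torsion_def)
    have "(g \<otimes> x \<otimes> inv g) [^] q = g \<otimes> x [^] q \<otimes> inv g" for q :: nat
      by (induct q) (use xc g in \<open>simp_all add: m_assoc\<close>)
    then show ?thesis
      using x g Kc T by (simp add: torsion_def)
  qed
  ultimately show ?thesis
    by (auto simp: normal_inv_iff)
qed

lemma torsion_Suc: "torsion r \<subseteq> torsion (Suc r)"
proof
  fix x assume x: "x \<in> torsion r"
  then have "(x [^] (e ^ r)) [^] e \<in> comm_sub K K"
    using K'_normal by (auto simp: torsion_def nat_pow_mem_subgroup normal_imp_subgroup)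
  then show "x \<in> torsion (Suc r)"
    using x normal_closed(1)[OF K_normal] by (auto simp: torsion_def nat_pow_pow mult.commute)
qed

lemma torsion_mono: "r \<le> r' \<Longrightarrow> torsion r \<subseteq> torsion r'"
  using torsion_Suc by (rule lift_Suc_mono_le)

section \<open>Torsion from repetitions among the values\<close>

definition shrink :: "nat set \<Rightarrow> 'a set \<Rightarrow> nat \<Rightarrow> 'a set"
  where "shrink I P i = (if i \<in> I then N i \<inter> P else N i)"

lemma shrink_normal: "P \<lhd> G \<Longrightarrow> shrink I P i \<lhd> G"
  by (simp add: shrink_def N_normal normal_subgroup_intersect)

lemma shrink_single: "shrink {i} P = N(i := N i \<inter> P)"
  by (auto simp: shrink_def fun_eq_iff)

text \<open>
  If the word is power linear in the arguments of index \<open>i \<in> I\<close>, then suitable powers of its value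
  \<open>w\<close> are congruent to values on \<open>S\<close>; there are at most \<open>m\<close> of those, so some power
  of \<open>w\<close> is trivial.
\<close>

lemma torsion_step:
  assumes P: "P \<lhd> G" and I: "I \<subseteq> leaves t" "I \<noteq> {}"
    and lin: "\<And>i. i \<in> I \<Longrightarrow> power_linear (shrink I P) t (torsion r) i"
  shows "iter_comm t (shrink I P) \<subseteq> torsion (Suc r)"
proof -
  let ?T = "torsion r"
  define E where "E = (\<Prod>i\<in>leaves t. n i)"
  note T = normal_closed[OF torsion_normal[of r]]
  \<comment> \<open>Arguments with index outside \<open>I\<close> are drawn from \<open>S i\<close>
    from the start; \<open>X i\<close> is still a normal generating set of
    \<open>shrink I P i\<close>.\<close>
  define X where "X i = (if i \<in> I then N i \<inter> P else S i)" for i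
  have X: "normal_subset (X i) G" for i
    using P by (simp add: X_def S_normal normal_subset_normal normal_subgroup_intersect N_normal)
  have "shrink I P = (\<lambda>i. generate G (X i))"
    using P by (auto simp: fun_eq_iff X_def shrink_def N_eq[symmetric] generate_subgroup_self
        normal_imp_subgroup normal_subgroup_intersect N_normal)
  then have "iter_comm t (shrink I P) = generate G (tree_values t X)"
    using iter_comm_generate[OF distinct_t, of X] X by simp
  moreover have "tree_word t x \<in> torsion (Suc r)" if x: "\<forall>i\<in>leaves t. x i \<in> X i" for x
  proof -
    define w where "w = tree_word t x"
    have SN: "S i \<subseteq> N i" for i
      by (auto simp: N_eq intro: generate.incl)
    have xM: "\<forall>i\<in>leaves t. x i \<in> shrink I P i"
      using x SN by (auto simp: X_def shrink_def split: if_splits)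
    have wK: "w \<in> K"
      unfolding w_def using xM by (intro tree_word_mem N_normal) (auto simp: shrink_def split: if_splits)
    then have wc: "w \<in> carrier G"
      using normal_closed(1)[OF K_normal] by auto
    \<comment> \<open>Each \<open>n i\<close> divides \<open>E\<close>, so these powers bring the
      arguments with index in \<open>I\<close> into \<open>S i\<close>; by linearity every
      replacement raises the value to the power \<open>E\<close> modulo \<open>?T\<close>.\<close>
    define y where "y J i = (if i \<in> J then x i [^] E else x i)" for J i
    have pw: "g [^] (q::nat) \<in> shrink I P i" if "g \<in> shrink I P i" for g i q
      using that shrink_normal[OF P] nat_pow_mem_subgroup normal_imp_subgroup by blast
    have yM: "\<forall>i\<in>leaves t. y J i \<in> shrink I P i" for J
      using xM pw by (auto simp: y_def)
    have ind: "\<exists>z\<in>?T. tree_word t (y J) = w [^] (E ^ card J) \<otimes> z" if "finite J" "J \<subseteq> I" for J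
      using that
    proof (induct J)
      case empty
      have "y {} = x"
        by (auto simp: y_def)
      then show ?case
        using T(2) wc by (auto simp: w_def intro!: bexI[of _ \<one>])
    next
      case (insert i J)
      then obtain z where z: "z \<in> ?T" "tree_word t (y J) = w [^] (E ^ card J) \<otimes> z"
        by auto
      have "y (insert i J) = (y J)(i := y J i [^] E)"
        using insert by (auto simp: y_def fun_eq_iff)
      moreover obtain z' where "z' \<in> ?T"
        "tree_word t ((y J)(i := y J i [^] E)) = tree_word t (y J) [^] E \<otimes> z'"
        using tree_word_pow[where M = "shrink I P", OF distinct_t shrink_normal[OF P] torsion_normal[of r], where i = i and x = "y J" and p = E]
          insert.prems I yM lin[of i] by auto
      moreover obtain z'' where "z'' \<in> ?T"
        "(w [^] (E ^ card J) \<otimes> z) [^] E = (w [^] (E ^ card J)) [^] E \<otimes> z''"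
        using pow_mult_normal[OF torsion_normal[of r], of "w [^] (E ^ card J)" z E] z wc by auto
      ultimately show ?case
        using z wc insert T(1) T(4)[of z'' z']
        by (auto simp: nat_pow_pow m_assoc subset_iff mult.commute simp del: fun_upd_apply intro!: bexI[of _ "z'' \<otimes> z'"])
    qed
    have finI: "finite I"
      using I(1) finite_leaves by (rule finite_subset)
    define W where "W = w [^] (E ^ card I)"
    have Wc: "W \<in> carrier G"
      using wc by (simp add: W_def)
    obtain z where z: "z \<in> ?T" "tree_word t (y I) = W \<otimes> z"
      using ind[OF finI] by (auto simp: W_def)
    obtain i where i: "i \<in> I"
      using I by auto
    \<comment> \<open>A further exponent at one index turns \<open>W\<close> into
      \<open>W [^] d\<close> modulo \<open>?T\<close> while the arguments stay in \<open>S\<close>.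
      The exponents \<open>0, ..., m\<close> give one value too many to be distinct.\<close>
    define yd where "yd d = (y I)(i := y I i [^] d)" for d :: nat
    have "\<exists>z\<in>?T. tree_word t (yd d) = W [^] d \<otimes> z" for d
    proof -
      obtain z' where "z' \<in> ?T" "tree_word t (yd d) = (W \<otimes> z) [^] d \<otimes> z'"
        unfolding yd_def
        using tree_word_pow[where M = "shrink I P", OF distinct_t shrink_normal[OF P] torsion_normal[of r], where i = i and x = "y I" and p = d]
          I yM lin[of i] z i by auto
      moreover obtain z'' where "z'' \<in> ?T" "(W \<otimes> z) [^] d = W [^] d \<otimes> z''"
        using pow_mult_normal[OF torsion_normal[of r], of W z d] z Wc by auto
      ultimately show ?thesis
        using T(1) T(4)[of z'' z'] Wc by (auto simp: m_assoc subset_iff intro!: bexI[of _ "z'' \<otimes> z'"])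
    qed
    then obtain zd where zd: "\<And>d. zd d \<in> ?T" "\<And>d. tree_word t (yd d) = W [^] d \<otimes> zd d"
      by metis
    have "tree_word t (yd d) \<in> tree_values t S" for d
    proof -
      have *: "x j [^] (E * q) \<in> S j" if j: "j \<in> I" for j and q :: nat
      proof -
        have jt: "j \<in> leaves t"
          using j I(1) by blast
        have xj: "x j \<in> N j"
          using bspec[OF x jt] j by (simp add: X_def)
        have "n j dvd E"
          using jt by (auto simp: E_def intro!: dvd_prodI)
        then have "n j dvd E * q"
          by (rule dvd_mult2)
        then obtain k where k: "E * q = k * n j"
          by (metis dvdE mult.commute)
        have "(x j [^] k) [^] n j \<in> S j"
          using xj nat_pow_mem_subgroup N_normal normal_imp_subgroup by (blast intro: S_pow)
        then show ?thesis
          using k xj normal_closed(1)[OF N_normal, of j] by (auto simp: nat_pow_pow)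
      qed
      have "yd d j \<in> S j" if j: "j \<in> leaves t" for j
      proof (cases "j \<in> I")
        case True
        then have "x j \<in> carrier G"
          using bspec[OF x j] normal_closed(1)[OF N_normal, of j] by (auto simp: X_def)
        then show ?thesis
          using *[OF True, of d] *[OF True, of 1] True by (auto simp: yd_def y_def nat_pow_pow)
      next
        case False
        then have "j \<noteq> i"
          using i by auto
        then show ?thesis
          using False bspec[OF x j] by (simp add: yd_def y_def X_def)
      qed
      then show ?thesis
        by (auto simp: tree_values_def)
    qed
    then have "card ((\<lambda>d. tree_word t (yd d)) ` {0..m}) \<le> m"
      using card_mono[OF finite_values, of "(\<lambda>d. tree_word t (yd d)) ` {0..m}"] card_values by force
    then have "\<not> inj_on (\<lambda>d. tree_word t (yd d)) {0..m}"
      using card_image by fastforce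
    then obtain d1 d2 where "d1 \<le> m" "d2 \<le> m" "d1 \<noteq> d2" "tree_word t (yd d1) = tree_word t (yd d2)"
      by (auto simp: inj_on_def)
    then obtain d1 d2 where d: "d1 < d2" "d2 \<le> m" "W [^] d1 \<otimes> zd d1 = W [^] d2 \<otimes> zd d2"
      by (metis linorder_neqE_nat zd(2))
    have zdc: "zd d \<in> carrier G" for d
      using zd T(1) by auto
    define q where "q = d2 - d1"
    have "W [^] d1 \<otimes> zd d1 = W [^] d1 \<otimes> (W [^] q \<otimes> zd d2)"
      using d Wc zdc by (simp add: q_def m_assoc[symmetric] nat_pow_mult)
    then have "zd d1 = W [^] q \<otimes> zd d2"
      using Wc zdc by simp
    then have "W [^] q = zd d1 \<otimes> inv (zd d2)"
      using Wc zdc by (simp add: inv_solve_right)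
    then have Wq: "W [^] q \<in> ?T"
      using zd T(3,4) by simp
    have "q dvd fact m"
      using d by (auto simp: q_def intro!: dvd_fact)
    moreover have "card I \<le> L"
      unfolding L_def using I by (simp add: card_mono)
    ultimately have "E ^ card I * q dvd E ^ L * fact m"
      by (intro mult_dvd_mono le_imp_power_dvd)
    then obtain k where "E ^ L * fact m = E ^ card I * q * k" ..
    then have k: "e = E ^ card I * q * k"
      unfolding e_def E_def[symmetric] by (simp add: mult.commute)
    have "(W [^] q) [^] k \<in> ?T"
      using Wq torsion_normal nat_pow_mem_subgroup normal_imp_subgroup by blast
    then have "w [^] e \<in> ?T"
      using wc by (simp add: W_def nat_pow_pow k)
    then have "(w [^] e) [^] (e ^ r) \<in> comm_sub K K"
      by (simp add: torsion_def)
    then show ?thesis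
      using wK wc by (simp add: torsion_def nat_pow_pow w_def)
  qed
  then have "tree_values t X \<subseteq> torsion (Suc r)"
    by (auto simp: tree_values_def)
  then have "generate G (tree_values t X) \<subseteq> torsion (Suc r)"
    by (intro generate_subgroup_incl normal_imp_subgroup torsion_normal)
  ultimately show ?thesis
    by simp
qed

end

section \<open>Induction on the nodes whose subgroup does not contain P\<close>

context power_generated_tree
begin

text \<open>This vanishes exactly for \<open>P \<subseteq> K\<close>, since \<open>K\<close> lies in
  the subgroup of every node. Intersecting \<open>P\<close> with the subgroup of a counted node
  removes that node from the count and adds none.\<close>

definition defect :: "'a set \<Rightarrow> nat"
  where "defect P = card {u \<in> subtrees t. \<not> P \<subseteq> iter_comm u N}"

lemma defect_less:
  assumes "P' \<subseteq> P" "u \<in> subtrees t" "P' \<subseteq> iter_comm u N" "\<not> P \<subseteq> iter_comm u N"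
  shows "defect P' < defect P"
  unfolding defect_def using assms by (intro psubset_card_mono) auto

text \<open>Let \<open>D\<close> be the subgroup of the node; then
  \<open>[P, P] \<subseteq> D\<close>. Commuting \<open>P\<close> with an entry already cut down to
  \<open>P\<close> gives a term with \<open>P \<inter> D\<close>, which is known. Commuting it with
  any other entry cuts down one entry more. Hence the induction runs from large \<open>I\<close> to
  small \<open>I\<close>, with one torsion step for each size.\<close>

lemma shrink_nonclosed:
  assumes P: "P \<lhd> G" and v: "Br a b \<in> subtrees t"
    and Pab: "P \<subseteq> iter_comm a N" "P \<subseteq> iter_comm b N"
    and IH: "\<And>j. j \<in> leaves t \<Longrightarrow>
      iter_comm t (N(j := N j \<inter> (P \<inter> iter_comm (Br a b) N))) \<subseteq> torsion r"
    and I: "I \<subseteq> leaves t" "I \<noteq> {}"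
  shows "iter_comm t (shrink I P) \<subseteq> torsion (r + 1 + L - card I)"
  using I
proof (induct "L - card I" arbitrary: I rule: less_induct)
  case less
  have finI: "finite I"
    using less.prems(1) finite_leaves by (rule finite_subset)
  have cI: "card I \<le> L"
    unfolding L_def using less by (simp add: card_mono)
  let ?r = "r + L - card I" and ?M = "shrink I P"
  have "iter_comm t ?M \<subseteq> torsion (Suc ?r)"
  proof (rule torsion_step[OF P less.prems])
    fix i assume i: "i \<in> I"
    show "power_linear ?M t (torsion ?r) i"
    proof (rule power_linear_Leibniz[of ?M "torsion ?r" P])
      show "iter_comm t (?M(j := comm_sub P (?M j))) \<subseteq> torsion ?r" if j: "j \<in> leaves t" for j
      proof (cases "j \<in> I")
        case True
        have "comm_sub P (?M j) \<subseteq> comm_sub P P"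
          using True by (intro comm_sub_mono) (auto simp: shrink_def)
        moreover have "comm_sub P P \<subseteq> iter_comm (Br a b) N"
          using comm_sub_mono[OF Pab] by simp
        moreover have "comm_sub P (?M j) \<subseteq> ?M j \<inter> P"
          using P by (intro comm_sub_subset_Int shrink_normal)
        ultimately have "comm_sub P (?M j) \<subseteq> N j \<inter> (P \<inter> iter_comm (Br a b) N)"
          using True by (auto simp: shrink_def)
        then have "iter_comm t (?M(j := comm_sub P (?M j))) \<subseteq>
            iter_comm t (N(j := N j \<inter> (P \<inter> iter_comm (Br a b) N)))"
          by (intro iter_comm_mono) (auto simp: shrink_def)
        also have "\<dots> \<subseteq> torsion r"
          by (rule IH[OF j])
        also have "\<dots> \<subseteq> torsion ?r"
          using cI by (intro torsion_mono) auto
        finally show ?thesis .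
      next
        case False
        have "comm_sub P (?M j) \<subseteq> ?M j \<inter> P"
          using P by (intro comm_sub_subset_Int shrink_normal)
        then have "iter_comm t (?M(j := comm_sub P (?M j))) \<subseteq> iter_comm t (shrink (insert j I) P)"
          using False by (intro iter_comm_mono) (auto simp: shrink_def)
        also have "\<dots> \<subseteq> torsion (r + 1 + L - card (insert j I))"
        proof (rule less.hyps)
          have "card (insert j I) \<le> L"
            unfolding L_def using less.prems j by (intro card_mono) auto
          then show "L - card (insert j I) < L - card I"
            using False finI by simp
        qed (use less j in auto)
        also have "r + 1 + L - card (insert j I) = ?r"
          using False finI by simp
        finally show ?thesis .
      qed
      show "?M i \<subseteq> P"
        using i by (auto simp: shrink_def)
      show "i \<in> leaves t"
        using i less.prems by auto
    qed (use P distinct_t in \<open>simp_all add: shrink_normal torsion_normal\<close>)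
  qed
  moreover have "Suc ?r = r + 1 + L - card I"
    using cI by simp
  ultimately show ?case
    by simp
qed

text \<open>By closedness, a node whose subgroup does not contain \<open>P\<close> has a child of
  the same kind, so such nodes can be followed down to a leaf \<open>i\<close>, where
  \<open>N i \<inter> P = N i \<inter> (P \<inter> N i)\<close> is covered by \<open>IH\<close>. On
  the way back up, the leaves below a child whose subgroup does contain \<open>P\<close> are reached
  through its sibling.\<close>

lemma shrink_closed:
  assumes P: "P \<lhd> G"
    and closed: "\<And>a b. Br a b \<in> subtrees t \<Longrightarrow> P \<subseteq> iter_comm a N \<Longrightarrow> P \<subseteq> iter_comm b N \<Longrightarrow>
      P \<subseteq> iter_comm (Br a b) N"
    and IH: "\<And>u j. u \<in> subtrees t \<Longrightarrow> \<not> P \<subseteq> iter_comm u N \<Longrightarrow> j \<in> leaves t \<Longrightarrow>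
      iter_comm t (N(j := N j \<inter> (P \<inter> iter_comm u N))) \<subseteq> torsion r"
    and s: "s \<in> subtrees t" "\<not> P \<subseteq> iter_comm s N" "i \<in> leaves s"
  shows "iter_comm t (N(i := N i \<inter> P)) \<subseteq> torsion (r + card (leaves s))"
  using s
proof (induct s arbitrary: i)
  case (Lf k)
  then have "iter_comm t (N(i := N i \<inter> (P \<inter> N i))) \<subseteq> torsion r"
    using IH[of "Lf k" i] subtrees_leaves[OF Lf(1)] by auto
  moreover have "N i \<inter> (P \<inter> N i) = N i \<inter> P"
    by auto
  ultimately show ?case
    using torsion_mono[of r "r + 1"] by (auto simp del: fun_upd_apply)
next
  case (Br a b)
  let ?r = "r + card (leaves (Br a b))"
  have sub: "a \<in> subtrees t" "b \<in> subtrees t" "leaves a \<subseteq> leaves t" "leaves b \<subseteq> leaves t"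
    using Br.prems(1) subtrees_trans[of _ "Br a b" t] subtrees_leaves[of _ t] by auto
  have c: "card (leaves a) + card (leaves b) = card (leaves (Br a b))"
    using subtrees_distinct[OF Br.prems(1) distinct_t] by (auto simp: card_Un_disjoint)
  \<comment> \<open>The branch entered through its sibling has at least one leaf; this pays for the
    additional torsion step in \<open>sib\<close>.\<close>
  have pos: "card (leaves s) > 0" for s
    by (simp add: card_gt_0_iff)
  have sib: "iter_comm t (N(i := N i \<inter> P)) \<subseteq> torsion (Suc (r + card (leaves w)))"
    if w: "w \<in> subtrees t" "\<not> P \<subseteq> iter_comm w N" and u: "P \<subseteq> iter_comm u N" "i \<in> leaves u"
      and v: "Br a b = Br u w \<or> Br a b = Br w u"
      and leaf: "\<And>j. j \<in> leaves w \<Longrightarrow>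
        iter_comm t (N(j := N j \<inter> P)) \<subseteq> torsion (r + card (leaves w))" for u w
    unfolding shrink_single[symmetric]
  proof (rule torsion_step[OF P])
    fix i' assume "i' \<in> {i}"
    then have i': "i' = i"
      by simp
    show "power_linear (shrink {i} P) t (torsion (r + card (leaves w))) i'"
      unfolding shrink_single i'
    proof (rule power_linear_sibling[OF N_normal P torsion_normal distinct_t Br.prems(1) v u(2,1)])
      fix j assume "j \<in> leaves t"
      then show "iter_comm t (N(j := N j \<inter> (P \<inter> iter_comm w N))) \<subseteq> torsion (r + card (leaves w))"
        using IH[OF w, of j] torsion_mono[of r "r + card (leaves w)"] by auto
    qed (rule leaf)
  qed (use u v sub in auto)
  show ?case
  proof (cases "P \<subseteq> iter_comm a N")
    case True
    then have Pb: "\<not> P \<subseteq> iter_comm b N"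
      using closed[OF Br.prems(1)] Br.prems(2) by auto
    note b = Br.hyps(2)[OF sub(2) Pb]
    show ?thesis
    proof (cases "i \<in> leaves b")
      case True
      then show ?thesis
        using b torsion_mono[of "r + card (leaves b)" ?r] c by fastforce
    next
      case False
      then show ?thesis
        using sib[OF sub(2) Pb True _ _ b] Br.prems(3) torsion_mono[of "Suc (r + card (leaves b))" ?r]
          c pos[of a] by fastforce
    qed
  next
    case Pa: False
    note a = Br.hyps(1)[OF sub(1) Pa]
    show ?thesis
    proof (cases "i \<in> leaves a")
      case True
      then show ?thesis
        using a torsion_mono[of "r + card (leaves a)" ?r] c by fastforce
    next
      case False
      then have ib: "i \<in> leaves b"
        using Br.prems by auto
      show ?thesis
      proof (cases "P \<subseteq> iter_comm b N")
        case True
        then show ?thesis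
          using sib[OF sub(1) Pa True ib _ a] torsion_mono[of "Suc (r + card (leaves a))" ?r]
            c pos[of b] by fastforce
      next
        case False
        then show ?thesis
          using Br.hyps(2)[OF sub(2) False ib] torsion_mono[of "r + card (leaves b)" ?r] c by fastforce
      qed
    qed
  qed
qed

text \<open>Origin of the exponent: one torsion step for \<open>P \<subseteq> K\<close>, where
  \<open>P\<close> is abelian because it centralizes \<open>K\<close>, and \<open>L\<close> more for
  each unit of \<open>defect\<close>, whether or not some node fails to contain \<open>P\<close>
  while both its children do.\<close>

lemma shrink_centralizer:
  assumes "P \<lhd> G" "P \<subseteq> colon {\<one>} K" "i \<in> leaves t"
  shows "iter_comm t (N(i := N i \<inter> P)) \<subseteq> torsion (Suc (defect P * L))"
  using assms
proof (induct "defect P" arbitrary: P i rule: less_induct)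
  case (less P)
  show ?case
  proof (cases "P \<subseteq> K")
    case True
    have one: "{\<one>} \<lhd> G"
      by (rule one_is_normal)
    have "P \<subseteq> colon {\<one>} P"
      using less.prems(2) colon_mono[of "{\<one>}" "{\<one>}" P K] True by auto
    then have "comm_sub P P \<subseteq> {\<one>}"
      using comm_sub_subset_iff[OF one] less.prems normal_closed(1) by blast
    then have PP: "comm_sub P P \<subseteq> torsion 0"
      using normal_closed(2)[OF torsion_normal] by blast
    have "iter_comm t (shrink {i} P) \<subseteq> torsion (Suc 0)"
    proof (rule torsion_step[OF less.prems(1)])
      fix j assume "j \<in> {i}"
      then have "j \<in> leaves t" "shrink {i} P j \<subseteq> P"
        using less.prems(3) by (auto simp: shrink_def)
      then show "power_linear (shrink {i} P) t (torsion 0) j"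
        by (intro power_linear_abelian[OF shrink_normal[OF less.prems(1)] torsion_normal _ _ PP distinct_t])
    qed (use less in auto)
    then show ?thesis
      using torsion_mono[of "Suc 0" "Suc (defect P * L)"] by (auto simp: shrink_single)
  next
    case False
    let ?r = "Suc ((defect P - 1) * L)"
    have IH: "iter_comm t (N(j := N j \<inter> (P \<inter> iter_comm u N))) \<subseteq> torsion ?r"
      if u: "u \<in> subtrees t" "\<not> P \<subseteq> iter_comm u N" and j: "j \<in> leaves t" for u j
    proof -
      have d: "defect (P \<inter> iter_comm u N) < defect P"
        using u by (intro defect_less) auto
      have "iter_comm t (N(j := N j \<inter> (P \<inter> iter_comm u N))) \<subseteq>
          torsion (Suc (defect (P \<inter> iter_comm u N) * L))"
        using less.prems d j by (intro less.hyps) (auto intro!: normal_subgroup_intersect iter_comm_normal N_normal)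
      also have "\<dots> \<subseteq> torsion ?r"
        using d by (intro torsion_mono Suc_le_mono[THEN iffD2] mult_le_mono1) linarith
      finally show ?thesis .
    qed
    have "defect P > 0"
      using defect_less[of "P \<inter> K" P t] False by auto
    then obtain k where k: "defect P = Suc k"
      by (metis gr0_implies_Suc)
    show ?thesis
    proof (cases "\<exists>a b. Br a b \<in> subtrees t \<and> P \<subseteq> iter_comm a N \<and> P \<subseteq> iter_comm b N \<and>
        \<not> P \<subseteq> iter_comm (Br a b) N")
      case True
      then obtain a b where ab: "Br a b \<in> subtrees t" "P \<subseteq> iter_comm a N" "P \<subseteq> iter_comm b N"
        "\<not> P \<subseteq> iter_comm (Br a b) N"
        by blast
      have "iter_comm t (shrink {i} P) \<subseteq> torsion (?r + 1 + L - card {i})"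
        using less.prems ab IH[OF ab(1,4)] by (intro shrink_nonclosed[of P a b ?r]) auto
      then show ?thesis
        using k by (simp add: shrink_single add.commute)
    next
      case closed: False
      have "iter_comm t (N(i := N i \<inter> P)) \<subseteq> torsion (?r + card (leaves t))"
        using closed IH less.prems(1,3) False subtrees_refl[of t] by (intro shrink_closed[of P]) blast+
      then show ?thesis
        using k by (simp add: L_def add.commute)
    qed
  qed
qed

end

section \<open>Schur and Dietzmann\<close>

lemma card_image_factor:
  assumes "\<And>x y. x \<in> S \<Longrightarrow> y \<in> S \<Longrightarrow> g x = g y \<Longrightarrow> f x = f y" "finite (g ` S)"
  shows "finite (f ` S)" "card (f ` S) \<le> card (g ` S)"
proof -
  have "f ` S \<subseteq> (\<lambda>z. f (inv_into S g z)) ` g ` S"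
  proof
    fix w assume "w \<in> f ` S"
    then obtain x where x: "x \<in> S" "w = f x"
      by auto
    then have "f (inv_into S g (g x)) = f x"
      by (intro assms) (auto simp: inv_into_into f_inv_into_f)
    then show "w \<in> (\<lambda>z. f (inv_into S g z)) ` g ` S"
      using x by force
  qed
  then show "finite (f ` S)" "card (f ` S) \<le> card (g ` S)"
    using finite_subset[OF _ finite_imageI[OF assms(2)]] surj_card_le[OF assms(2)] by blast+
qed

text \<open>The number of words of length at most \<open>k * q\<close> in an alphabet of
  \<open>k\<close> letters.\<close>

definition gen_bound :: "nat \<Rightarrow> nat \<Rightarrow> nat"
  where "gen_bound k q = (\<Sum>i\<le>k * q. k ^ i)"

context group
begin

section \<open>Products over a finite normal set\<close>

lemma pow_commute:
  assumes "x \<in> carrier G"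
  shows "x \<otimes> x [^] (k::nat) = x [^] k \<otimes> x"
    and "y \<in> carrier G \<Longrightarrow> x \<otimes> (x [^] k \<otimes> y) = x [^] k \<otimes> (x \<otimes> y)"
proof -
  show *: "x \<otimes> x [^] k = x [^] k \<otimes> x"
    using nat_pow_Suc2[OF assms, of k] nat_pow_Suc[of x k] by metis
  show "x \<otimes> (x [^] k \<otimes> y) = x [^] k \<otimes> (x \<otimes> y)" if "y \<in> carrier G"
    using that assms * by (simp flip: m_assoc)
qed

abbreviation lprod :: "'a list \<Rightarrow> 'a"
  where "lprod xs \<equiv> foldr (\<otimes>) xs \<one>"

lemma lprod_closed [simp]: "set xs \<subseteq> carrier G \<Longrightarrow> lprod xs \<in> carrier G"
  by (induct xs) auto

lemma lprod_append:
  "set xs \<subseteq> carrier G \<Longrightarrow> set ys \<subseteq> carrier G \<Longrightarrow> lprod (xs @ ys) = lprod xs \<otimes> lprod ys"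
  by (induct xs) (auto simp: m_assoc)

lemma lprod_replicate: "x \<in> carrier G \<Longrightarrow> lprod (replicate k x) = x [^] k"
  by (induct k) (auto simp: pow_commute)

text \<open>By \<open>y \<otimes> x = x \<otimes> (inv x \<otimes> y \<otimes> x)\<close>, a factor
  \<open>x\<close> moves to the left at the price of conjugating the factors it passes; these stay
  in \<open>X\<close>, and their number does not change.\<close>

lemma lprod_collect:
  assumes X: "X \<subseteq> carrier G" "\<And>x y. x \<in> X \<Longrightarrow> y \<in> X \<Longrightarrow> inv x \<otimes> y \<otimes> x \<in> X" and x: "x \<in> X"
    and "set xs \<subseteq> X" "j \<le> count_list xs x"
  shows "\<exists>ys. set ys \<subseteq> X \<and> length ys + j = length xs \<and> lprod xs = x [^] j \<otimes> lprod ys"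
  using assms(4,5)
proof (induct xs arbitrary: j)
  case Nil
  then show ?case by simp
next
  case (Cons y xs)
  have xc: "x \<in> carrier G" "y \<in> carrier G" "set xs \<subseteq> carrier G"
    using X x Cons.prems by auto
  have conj: "inv (x [^] j) \<otimes> y \<otimes> x [^] j \<in> X" for j :: nat
  proof (induct j)
    case 0
    then show ?case
      using Cons.prems xc by simp
  next
    case (Suc j)
    have "inv (x [^] Suc j) \<otimes> y \<otimes> x [^] Suc j = inv x \<otimes> (inv (x [^] j) \<otimes> y \<otimes> x [^] j) \<otimes> x"
      using xc by (simp add: inv_mult_group m_assoc)
    then show ?case
      using X(2)[OF x Suc] by simp
  qed
  show ?case
  proof (cases "x = y \<and> j > 0")
    case True
    then obtain j' where j: "j = Suc j'"
      by (metis gr0_implies_Suc)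
    then obtain ys where "set ys \<subseteq> X" "length ys + j' = length xs" "lprod xs = x [^] j' \<otimes> lprod ys"
      using Cons.hyps[of j'] Cons.prems True by auto
    moreover from this have "lprod (y # xs) = x [^] j \<otimes> lprod ys"
      using True xc X j by (simp add: pow_commute m_assoc)
    ultimately show ?thesis
      using j by auto
  next
    case False
    then have "j \<le> count_list xs x"
      using Cons.prems by (cases "x = y") auto
    then obtain ys where ys: "set ys \<subseteq> X" "length ys + j = length xs" "lprod xs = x [^] j \<otimes> lprod ys"
      using Cons.hyps[of j] Cons.prems(1) by force
    moreover have "set ys \<subseteq> carrier G"
      using ys X(1) by blast
    then have "lprod (y # xs) = x [^] j \<otimes> lprod ((inv (x [^] j) \<otimes> y \<otimes> x [^] j) # ys)"
      using ys xc by (simp add: m_assoc)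
    ultimately show ?thesis
      using conj[of j] by (intro exI[of _ "(inv (x [^] j) \<otimes> y \<otimes> x [^] j) # ys"]) auto
  qed
qed

text \<open>
  A common form of the lemma of Dietzmann and the final step of Schur's theorem: in a product of more
  than \<open>card X * q\<close> factors some \<open>x\<close> occurs more than \<open>q\<close> times, and collecting these
  occurrences on the left makes the product shorter.
\<close>

lemma lprod_shorten:
  assumes X: "X \<subseteq> carrier G" "\<And>x y. x \<in> X \<Longrightarrow> y \<in> X \<Longrightarrow> inv x \<otimes> y \<otimes> x \<in> X" "finite X"
    and pow: "\<And>x. x \<in> X \<Longrightarrow> \<exists>ys. set ys \<subseteq> X \<and> length ys \<le> q \<and> x [^] Suc q = lprod ys"
    and "set xs \<subseteq> X"
  shows "\<exists>ys. set ys \<subseteq> X \<and> length ys \<le> card X * q \<and> lprod ys = lprod xs"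
  using assms(5)
proof (induct "length xs" arbitrary: xs rule: less_induct)
  case less
  show ?case
  proof (cases "length xs \<le> card X * q")
    case False
    have "\<exists>x\<in>X. Suc q \<le> count_list xs x"
    proof (rule ccontr)
      assume "\<not> ?thesis"
      then have "(\<Sum>x\<in>X. count_list xs x) \<le> (\<Sum>x\<in>X. q)"
        by (intro sum_mono) (auto simp: not_less_eq_eq)
      then show False
        using False sum_count_set[OF less.prems X(3)] by simp
    qed
    then obtain x where x: "x \<in> X" "Suc q \<le> count_list xs x"
      by blast
    obtain ys where ys: "set ys \<subseteq> X" "length ys + Suc q = length xs" "lprod xs = x [^] Suc q \<otimes> lprod ys"
      using lprod_collect[OF X(1,2) x(1) less.prems x(2)] by auto
    obtain zs where zs: "set zs \<subseteq> X" "length zs \<le> q" "x [^] Suc q = lprod zs"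
      using pow[OF x(1)] by blast
    have "lprod (zs @ ys) = lprod xs"
      using ys zs X(1) by (subst lprod_append) auto
    then show ?thesis
      using less.hyps[of "zs @ ys"] ys zs by auto
  qed (use less in auto)
qed

lemma generate_eq_lprod:
  assumes X: "X \<subseteq> carrier G" "\<And>x. x \<in> X \<Longrightarrow> inv x \<in> X" and "g \<in> generate G X"
  shows "\<exists>xs. set xs \<subseteq> X \<and> g = lprod xs"
  using assms(3)
proof induct
  case one
  show ?case by (intro exI[of _ "[]"]) simp
next
  case (incl h)
  then show ?case using X by (intro exI[of _ "[h]"]) auto
next
  case (inv h)
  then show ?case using X by (intro exI[of _ "[inv h]"]) auto
next
  case (eng g h)
  then obtain xs ys where "set xs \<subseteq> X" "g = lprod xs" "set ys \<subseteq> X" "h = lprod ys"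
    by blast
  then show ?case
    using X by (intro exI[of _ "xs @ ys"]) (auto simp: lprod_append simp del: foldr_append)
qed

lemma generate_bounded:
  assumes X: "normal_subset X G" "finite X" "card X \<le> k" "\<And>x. x \<in> X \<Longrightarrow> inv x \<in> X"
    and pow: "\<And>x. x \<in> X \<Longrightarrow> \<exists>ys. set ys \<subseteq> X \<and> length ys \<le> q \<and> x [^] Suc q = lprod ys"
  shows "finite (generate G X)" "card (generate G X) \<le> gen_bound k q"
proof -
  have Xc: "X \<subseteq> carrier G" "\<And>x y. x \<in> X \<Longrightarrow> y \<in> X \<Longrightarrow> inv x \<otimes> y \<otimes> x \<in> X"
    using X(1) by (auto simp: normal_subset_def)
  let ?L = "{xs. set xs \<subseteq> X \<and> length xs \<le> k * q}"
  have "generate G X \<subseteq> lprod ` ?L"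
  proof
    fix g assume "g \<in> generate G X"
    then obtain xs where xs: "set xs \<subseteq> X" "g = lprod xs"
      using generate_eq_lprod[OF Xc(1) X(4)] by blast
    obtain ys where "set ys \<subseteq> X" "length ys \<le> card X * q" "lprod ys = lprod xs"
      using lprod_shorten[OF Xc X(2) pow xs(1)] by blast
    moreover from this(2) have "length ys \<le> k * q"
      using mult_le_mono1[OF X(3), of q] by linarith
    ultimately show "g \<in> lprod ` ?L"
      using xs(2) by (intro image_eqI[of _ _ ys]) auto
  qed
  moreover have "finite ?L"
    using X(2) by (rule finite_lists_length_le)
  moreover have "card ?L \<le> gen_bound k q"
    unfolding gen_bound_def using X(2,3) by (auto simp: card_lists_length_le intro!: sum_mono power_mono)
  ultimately show "finite (generate G X)" "card (generate G X) \<le> gen_bound k q"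
    using surj_card_le[of ?L "generate G X" lprod] finite_subset[OF _ finite_imageI[of ?L lprod]]
    by auto
qed

text \<open>The classical reduction in Schur's theorem. With \<open>c = [x, y]\<close>, the power
  \<open>c^n\<close> equals its conjugate by \<open>y\<close>, so
  \<open>c^(n+1) = c (y^-1 c y) (y^-1 c y)^(n-1)\<close>, and
  \<open>c (y^-1 c y) = [x, y^2]\<close>. Thus \<open>n + 1\<close> commutators are rewritten as
  \<open>n\<close>.\<close>

lemma commutator_pow_Suc:
  assumes "x \<in> carrier G" "y \<in> carrier G" "n > 0"
    and "commutator G x y [^] (n::nat) \<otimes> y = y \<otimes> commutator G x y [^] n"
  shows "commutator G x y [^] Suc n =
    commutator G x (y \<otimes> y) \<otimes> commutator G (inv y \<otimes> x \<otimes> y) y [^] (n - 1)"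
proof -
  define c where "c = commutator G x y"
  have c: "c \<in> carrier G"
    using assms by (simp add: c_def)
  have pw: "(inv y \<otimes> c \<otimes> y) [^] k = inv y \<otimes> c [^] k \<otimes> y" for k :: nat
    by (induct k) (use assms c in \<open>simp_all add: m_assoc\<close>)
  define d where "d = c [^] n"
  define b where "b = c [^] (n - 1)"
  have db: "d \<in> carrier G" "b \<in> carrier G"
    using c by (simp_all add: d_def b_def)
  have cn: "d = c \<otimes> b"
    using nat_pow_Suc2[OF c, of "n - 1"] assms(3) by (simp add: d_def b_def)
  have ce: "c = inv x \<otimes> inv y \<otimes> x \<otimes> y"
    by (simp add: c_def commutator_def)
  have "c [^] Suc n = c \<otimes> d"
    using c by (simp add: pow_commute d_def)
  also have "\<dots> = inv x \<otimes> inv y \<otimes> x \<otimes> (y \<otimes> d)"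
    using assms(1,2) db by (simp add: ce m_assoc)
  also have "y \<otimes> d = c \<otimes> b \<otimes> y"
    using assms(4) cn by (simp add: c_def d_def)
  also have "inv x \<otimes> inv y \<otimes> x \<otimes> (c \<otimes> b \<otimes> y) = commutator G x (y \<otimes> y) \<otimes> (inv y \<otimes> b \<otimes> y)"
    using assms(1,2) db unfolding ce by (simp add: commutator_def m_assoc inv_mult_group)
  also have "inv y \<otimes> b \<otimes> y = commutator G (inv y \<otimes> x \<otimes> y) y [^] (n - 1)"
    using assms(1,2) pw[of "n - 1"] conj_commutator[of x y y] by (simp add: c_def b_def m_assoc)
  finally show ?thesis
    by (simp add: c_def)
qed

text \<open>For subgroups this bounds the index of \<open>A \<inter> T\<close> in \<open>A\<close>.
  Counting the cosets of \<open>T\<close> that meet \<open>A\<close> gives it a meaning also if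
  \<open>T\<close> is not contained in \<open>A\<close>.\<close>

definition bounded_index :: "'a set \<Rightarrow> 'a set \<Rightarrow> nat \<Rightarrow> bool"
  where "bounded_index T A p \<longleftrightarrow> finite ((#>) T ` A) \<and> card ((#>) T ` A) \<le> p"

lemma rcoset_eq_iff:
  assumes "T \<lhd> G" "x \<in> carrier G" "y \<in> carrier G"
  shows "T #> x = T #> y \<longleftrightarrow> x \<otimes> inv y \<in> T"
proof -
  interpret T: subgroup T G
    using assms(1) by (rule normal_imp_subgroup)
  have "T #> x = T #> y \<longleftrightarrow> x \<in> T #> y"
    using assms T.subset rcos_self[OF assms(2) T.subgroup_axioms]
      repr_independence[OF _ assms(3) T.subgroup_axioms] by blast
  also have "\<dots> \<longleftrightarrow> x \<otimes> inv y \<in> T"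
    using assms by (intro T.rcos_module is_group)
  finally show ?thesis .
qed

text \<open>Two of the powers with exponents \<open>0, ..., p\<close> share a coset of
  \<open>T\<close>, and the difference of their exponents divides \<open>fact p\<close>.\<close>

lemma bounded_index_pow:
  assumes T: "T \<lhd> G" and A: "A \<lhd> G" and p: "bounded_index T A p" and x: "x \<in> A"
  shows "x [^] (fact p :: nat) \<in> T"
proof -
  have xc: "x \<in> carrier G"
    using x normal_closed(1)[OF A] by auto
  have "(\<lambda>d. T #> x [^] d) ` {0..p} \<subseteq> (#>) T ` A"
    using A x by (auto simp: nat_pow_mem_subgroup normal_imp_subgroup)
  then have "card ((\<lambda>d. T #> x [^] d) ` {0..p}) \<le> p"
    using p card_mono unfolding bounded_index_def by (metis order_trans)
  then have "\<not> inj_on (\<lambda>d. T #> x [^] d) {0..p}"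
    using card_image by fastforce
  then obtain d1 d2 where "d1 \<le> p" "d2 \<le> p" "d1 \<noteq> d2" "T #> x [^] d1 = T #> x [^] d2"
    by (auto simp: inj_on_def)
  then obtain d1 d2 where d: "d1 < d2" "d2 \<le> p" "T #> x [^] d2 = T #> x [^] d1"
    by (metis linorder_neqE_nat)
  then have "x [^] d2 \<otimes> inv (x [^] d1) \<in> T"
    using rcoset_eq_iff[OF T] xc by simp
  moreover have "x [^] d2 \<otimes> inv (x [^] d1) = x [^] (d2 - d1)"
  proof -
    have "x [^] d2 = x [^] (d2 - d1) \<otimes> x [^] d1"
      using d(1) xc by (simp add: nat_pow_mult)
    then show ?thesis
      using xc by (simp add: m_assoc)
  qed
  ultimately have dT: "x [^] (d2 - d1) \<in> T"
    by simp
  have "d2 - d1 dvd fact p"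
    using d by (intro dvd_fact) auto
  then obtain k where "fact p = (d2 - d1) * k"
    by auto
  then have "x [^] (fact p :: nat) = (x [^] (d2 - d1)) [^] k"
    using xc by (simp add: nat_pow_pow)
  then show ?thesis
    using dT T by (simp add: nat_pow_mem_subgroup normal_imp_subgroup)
qed

text \<open>
  Schur's theorem relative to \<open>T\<close>; the case \<open>A = B = G\<close>, \<open>T = 1\<close> is the usual one.
\<close>

lemma bounded_index_comm_sub:
  assumes T: "T \<lhd> G" and A: "A \<lhd> G" and B: "B \<lhd> G"
    and p: "bounded_index (colon T B) A p" and q: "bounded_index (colon T A) B q"
  shows "bounded_index T (comm_sub A B) (gen_bound (p * q) (fact p))"
proof -
  note c = normal_closed(1)[OF T, THEN subsetD] normal_closed(1)[OF A, THEN subsetD]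
    normal_closed(1)[OF B, THEN subsetD]
  have col: "colon T A \<lhd> G" "colon T B \<lhd> G"
    using T A B by (auto intro: colon_normal normal_subset_normal)
  let ?Q = "G Mod T" and ?h = "(#>) T"
  interpret Q: group ?Q
    using T by (rule normal.factorgroup_is_group)
  interpret h: group_hom G ?Q ?h
    using normal.r_coset_hom_Mod[OF T] by unfold_locales
  let ?f = "\<lambda>(a, b). commutator G a b"
  let ?g = "\<lambda>(a, b). (colon T B #> a, colon T A #> b)"
  have hT: "?h x = ?h y" if "x \<otimes> inv y \<in> T" "x \<in> carrier G" "y \<in> carrier G" for x y
    using that rcoset_eq_iff[OF T] by simp
  \<comment> \<open>Modulo \<open>T\<close> a commutator depends on its first argument only through
    a coset of the \<open>colon\<close>. \<open>A\<close> and \<open>B\<close> are generalized here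
    so that the same fact, applied to inverse commutators, serves the second argument; together they
    leave at most \<open>p * q\<close> commutators modulo \<open>T\<close>.\<close>
  have left: "?h (commutator G a b) = ?h (commutator G a' b)"
    if "colon T B #> a = colon T B #> a'" "a \<in> A" "a' \<in> A" "b \<in> B" "A \<lhd> G" "B \<lhd> G" for a a' b A B
  proof (rule hT)
    have abc: "a \<in> carrier G" "a' \<in> carrier G" "b \<in> carrier G"
      using that normal_closed(1) by blast+
    have "colon T B \<lhd> G"
      using T that by (auto intro: colon_normal normal_subset_normal)
    then have "a \<otimes> inv a' \<in> colon T B"
      using rcoset_eq_iff that abc by blast
    then have "commutator G (a \<otimes> inv a') b \<in> T"
      using that by (simp add: colon_def)
    then have "inv a' \<otimes> commutator G (a \<otimes> inv a') b \<otimes> a' \<in> T"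
      using abc normal_closed(5)[OF T] by auto
    also have "inv a' \<otimes> commutator G (a \<otimes> inv a') b \<otimes> a' = commutator G a b \<otimes> inv (commutator G a' b)"
      using abc by (simp add: commutator_def m_assoc inv_mult_group)
    finally show "commutator G a b \<otimes> inv (commutator G a' b) \<in> T" .
  qed (use that normal_closed(1) in \<open>auto intro!: commutator_closed\<close>)
  define Y where "Y = {commutator G a b |a b. a \<in> A \<and> b \<in> B}"
  have Yf: "?h ` Y = (?h \<circ> ?f) ` (A \<times> B)"
    by (force simp: Y_def image_iff)
  have Yc: "Y \<subseteq> carrier G"
    using c by (auto simp: Y_def)
  have fin: "finite (?g ` (A \<times> B))" "card (?g ` (A \<times> B)) \<le> p * q"
  proof -
    have sub: "?g ` (A \<times> B) \<subseteq> (#>) (colon T B) ` A \<times> (#>) (colon T A) ` B"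
      by auto
    have fin: "finite ((#>) (colon T B) ` A \<times> (#>) (colon T A) ` B)"
      using p q by (simp add: bounded_index_def)
    show "finite (?g ` (A \<times> B))"
      using finite_subset[OF sub fin] .
    have "card ((#>) (colon T B) ` A \<times> (#>) (colon T A) ` B) \<le> p * q"
      using p q by (simp add: bounded_index_def card_cartesian_product mult_mono)
    then show "card (?g ` (A \<times> B)) \<le> p * q"
      using card_mono[OF fin sub] by linarith
  qed
  have factor: "(?h \<circ> ?f) u = (?h \<circ> ?f) v" if uv: "u \<in> A \<times> B" "v \<in> A \<times> B" "?g u = ?g v" for u v
  proof -
    obtain a b a' b' where ab: "u = (a, b)" "v = (a', b')"
      by fastforce
    have abc: "a \<in> carrier G" "a' \<in> carrier G" "b \<in> carrier G" "b' \<in> carrier G"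
      using uv ab c by auto
    have "?h (commutator G b a') = ?h (commutator G b' a')"
      using uv ab by (intro left[OF _ _ _ _ B A]) auto
    then have "inv\<^bsub>?Q\<^esub> (?h (commutator G b a')) = inv\<^bsub>?Q\<^esub> (?h (commutator G b' a'))"
      by simp
    then have "?h (commutator G a' b) = ?h (commutator G a' b')"
      using abc h.hom_inv[of "commutator G b a'"] h.hom_inv[of "commutator G b' a'"]
      by (simp add: inv_commutator)
    moreover have "?h (commutator G a b) = ?h (commutator G a' b)"
      using uv ab by (intro left[OF _ _ _ _ A B]) auto
    ultimately show ?thesis
      using ab by simp
  qed
  have Xfin: "finite (?h ` Y)" "card (?h ` Y) \<le> p * q"
  proof -
    have "finite ((?h \<circ> ?f) ` (A \<times> B))" "card ((?h \<circ> ?f) ` (A \<times> B)) \<le> card (?g ` (A \<times> B))"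
      by (rule card_image_factor[of "A \<times> B" ?g "?h \<circ> ?f", OF factor fin(1)], assumption+)+
    note factored = this
    show "finite (?h ` Y)"
      unfolding Yf by (rule factored(1))
    show "card (?h ` Y) \<le> p * q"
      unfolding Yf by (rule order_trans[OF factored(2) fin(2)])
  qed
  have hY: "commutator ?Q (?h a) (?h b) = ?h (commutator G a b)" if "a \<in> carrier G" "b \<in> carrier G" for a b
    using that by (simp add: commutator_def del: mult_FactGroup)
  have "generate ?Q (?h ` Y) = ?h ` comm_sub A B"
    using h.generate_img[OF Yc] by (simp add: comm_sub_def Y_def)
  moreover have "normal_subset (?h ` Y) ?Q"
  proof -
    have "normal_subset Y G"
      unfolding Y_def using A B by (intro normal_subset_commutators normal_subset_normal)
    then show ?thesis
      unfolding normal_subset_def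
      by (auto simp: carrier_FactGroup simp del: mult_FactGroup simp flip: h.hom_inv h.hom_mult)
  qed
  moreover have "inv\<^bsub>?Q\<^esub> x \<in> ?h ` Y" if xY: "x \<in> ?h ` Y" for x
  proof -
    obtain a b where ab: "a \<in> A" "b \<in> B" "x = ?h (commutator G a b)"
      using xY by (auto simp: Y_def)
    then have abc: "a \<in> carrier G" "b \<in> carrier G"
      using c by auto
    \<comment> \<open>The obvious inverse \<open>[b, a]\<close> has its arguments in the wrong order
      for \<open>Y\<close>; this form has the first in \<open>A\<close> and the second in
      \<open>B\<close>.\<close>
    have "inv (commutator G a b) = commutator G (inv a) (inv a \<otimes> b \<otimes> a)"
      using abc by (simp add: commutator_def m_assoc inv_mult_group)
    then have "inv (commutator G a b) \<in> Y"
      unfolding Y_def using normal_closed(3)[OF A ab(1)] normal_closed(5)[OF B ab(2) abc(1)] by blast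
    then show ?thesis
      using ab abc by (simp flip: h.hom_inv)
  qed
  moreover have "\<exists>ys. set ys \<subseteq> ?h ` Y \<and> length ys \<le> fact p \<and> x [^]\<^bsub>?Q\<^esub> Suc (fact p) = Q.lprod ys"
    if xY: "x \<in> ?h ` Y" for x
  proof -
    obtain a b where ab: "a \<in> A" "b \<in> B" "x = ?h (commutator G a b)"
      using xY by (auto simp: Y_def)
    then have abc: "a \<in> carrier G" "b \<in> carrier G"
      using c by auto
    define k where "k = commutator G a b"
    have k: "k \<in> A" "k \<in> carrier G"
      using ab abc normal_closed(7)[OF A] by (auto simp: k_def)
    \<comment> \<open>The commutator itself lies in \<open>A\<close>, so the index bound for
      \<open>A\<close> applies to it: its power with exponent \<open>fact p\<close> commutes with
      \<open>b\<close> modulo \<open>T\<close>.\<close>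
    have "k [^] (fact p :: nat) \<in> colon T B"
      using bounded_index_pow[OF col(2) A p k(1)] .
    then have "commutator G (k [^] (fact p :: nat)) b \<in> T"
      using ab by (simp add: colon_def)
    then have "commutator ?Q (?h (k [^] (fact p :: nat))) (?h b) = \<one>\<^bsub>?Q\<^esub>"
      using hY[of "k [^] (fact p :: nat)" b] k abc T
      by (simp add: coset_join2 normal_imp_subgroup c)
    then have "?h (k [^] (fact p :: nat)) \<otimes>\<^bsub>?Q\<^esub> ?h b = ?h b \<otimes>\<^bsub>?Q\<^esub> ?h (k [^] (fact p :: nat))"
      using Q.commute_iff_commutator[of "?h (k [^] (fact p :: nat))" "?h b"] k abc h.hom_closed
      by (simp del: mult_FactGroup)
    moreover have "?h (k [^] (fact p :: nat)) = commutator ?Q (?h a) (?h b) [^]\<^bsub>?Q\<^esub> (fact p :: nat)"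
      using hY[OF abc] h.hom_nat_pow[OF k(2), of "fact p"] by (simp add: k_def)
    ultimately have "commutator ?Q (?h a) (?h b) [^]\<^bsub>?Q\<^esub> Suc (fact p) =
        commutator ?Q (?h a) (?h b \<otimes>\<^bsub>?Q\<^esub> ?h b) \<otimes>\<^bsub>?Q\<^esub>
        commutator ?Q (inv\<^bsub>?Q\<^esub> (?h b) \<otimes>\<^bsub>?Q\<^esub> ?h a \<otimes>\<^bsub>?Q\<^esub> ?h b) (?h b) [^]\<^bsub>?Q\<^esub> (fact p - 1 :: nat)"
      using abc h.hom_closed by (intro Q.commutator_pow_Suc) auto
    also have "commutator ?Q (?h a) (?h b \<otimes>\<^bsub>?Q\<^esub> ?h b) = ?h (commutator G a (b \<otimes> b))"
      using abc hY by (simp del: mult_FactGroup flip: h.hom_mult)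
    also have "commutator ?Q (inv\<^bsub>?Q\<^esub> (?h b) \<otimes>\<^bsub>?Q\<^esub> ?h a \<otimes>\<^bsub>?Q\<^esub> ?h b) (?h b) =
        ?h (commutator G (inv b \<otimes> a \<otimes> b) b)"
      using abc hY by (simp del: mult_FactGroup flip: h.hom_mult h.hom_inv)
    finally have eq: "x [^]\<^bsub>?Q\<^esub> Suc (fact p) = ?h (commutator G a (b \<otimes> b)) \<otimes>\<^bsub>?Q\<^esub>
        ?h (commutator G (inv b \<otimes> a \<otimes> b) b) [^]\<^bsub>?Q\<^esub> (fact p - 1 :: nat)"
      using ab hY[OF abc] by simp
    have mem: "commutator G a (b \<otimes> b) \<in> Y" "commutator G (inv b \<otimes> a \<otimes> b) b \<in> Y"
      unfolding Y_def using ab(1,2) normal_closed(5)[OF A ab(1) abc(2)] normal_closed(4)[OF B ab(2) ab(2)]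
      by blast+
    \<comment> \<open>Here are \<open>1 + (fact p - 1) = fact p\<close> factors, one fewer than in
      the power on the left.\<close>
    let ?ys = "?h (commutator G a (b \<otimes> b)) # replicate (fact p - 1) (?h (commutator G (inv b \<otimes> a \<otimes> b) b))"
    have "Q.lprod ?ys = x [^]\<^bsub>?Q\<^esub> Suc (fact p)"
      using eq Q.lprod_replicate[of "?h (commutator G (inv b \<otimes> a \<otimes> b) b)" "fact p - 1"] abc h.hom_closed
      by (simp del: mult_FactGroup)
    moreover have "length ?ys \<le> fact p"
      using fact_ge_1[of p, where ?'a = nat] by simp
    ultimately show ?thesis
      using mem by (intro exI[of _ ?ys]) auto
  qed
  ultimately show ?thesis
    using Q.generate_bounded[of "?h ` Y" "p * q" "fact p"] Xfin by (simp add: bounded_index_def)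
qed

end

section \<open>The bound\<close>

text \<open>At a leaf, a bound for the number of maps from the set of values to itself; at a node,
  the bound in the relative theorem of Schur.\<close>

primrec index_bound :: "nat \<Rightarrow> ctree \<Rightarrow> nat" where
  "index_bound m (Lf i) = Suc m ^ m"
| "index_bound m (Br a b) = gen_bound (index_bound m a * index_bound m b) (fact (index_bound m a))"

text \<open>\<open>E\<close> stands for the product of the \<open>n i\<close>. The three factors
  take an element of \<open>K\<close> into the torsion subgroup modulo \<open>K'\<close>, from there
  into \<open>K'\<close>, and finally to \<open>\<one>\<close>; the last is the factorial of Schur's
  bound for \<open>K'\<close>, with \<open>Suc m ^ m\<close> bounding the index of the center of
  \<open>K\<close>.\<close>

definition exponent_bound :: "nat \<Rightarrow> ctree \<Rightarrow> nat \<Rightarrow> nat"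
  where "exponent_bound m t E =
    fact (index_bound m t) *
    (fact m * E ^ card (leaves t)) ^ Suc (card (subtrees t) * card (leaves t)) *
    fact (gen_bound (Suc m ^ m * Suc m ^ m) (fact (Suc m ^ m)))"

text \<open>The generators are the values and their inverses, hence \<open>2 * m\<close>.\<close>

definition order_bound :: "nat \<Rightarrow> ctree \<Rightarrow> nat \<Rightarrow> nat"
  where "order_bound m t E = gen_bound (2 * m) (exponent_bound m t E)"

section \<open>From index bounds to the order of K\<close>

context power_generated_tree
begin

abbreviation C where "C \<equiv> colon {\<one>} K"

lemma C_normal: "C \<lhd> G"
  by (intro colon_normal one_is_normal normal_subset_normal K_normal)

lemma centralize_values:
  assumes "z \<in> colon {\<one>} (tree_values t S)"
  shows "z \<in> C"
proof -
  let ?V = "tree_values t S"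
  have V: "normal_subset ?V G"
    using distinct_t S_normal by (rule tree_values_normal)
  then have Vc: "?V \<subseteq> carrier G"
    by (simp add: normal_subset_def)
  have cV: "colon {\<one>} ?V \<lhd> G"
    by (intro colon_normal one_is_normal V)
  note cc = normal_closed(1)[OF cV] normal_closed(1)[OF K_normal]
  have "?V \<subseteq> colon {\<one>} (colon {\<one>} ?V)"
    using colon_sym[OF one_is_normal cc(1) Vc] by simp
  moreover have "colon {\<one>} (colon {\<one>} ?V) \<lhd> G"
    by (intro colon_normal one_is_normal normal_subset_normal cV)
  ultimately have "K \<subseteq> colon {\<one>} (colon {\<one>} ?V)"
    unfolding K_generate by (intro generate_subgroup_incl normal_imp_subgroup)
  then show ?thesis
    using colon_sym[OF one_is_normal cc] assms by blast
qed

text \<open>Conjugation by \<open>x\<close> maps the set of values to itself, and the resulting map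
  determines \<open>x\<close> modulo \<open>C\<close>, because the values generate
  \<open>K\<close>.\<close>

lemma bounded_index_centralizer:
  assumes A: "A \<lhd> G" and T: "T \<lhd> G" and AT: "A \<inter> C \<subseteq> T"
  shows "bounded_index T A (Suc m ^ m)"
proof -
  let ?V = "tree_values t S"
  have V: "normal_subset ?V G"
    using distinct_t S_normal by (rule tree_values_normal)
  then have Vc: "?V \<subseteq> carrier G"
    by (simp add: normal_subset_def)
  note Ac = normal_closed[OF A]
  define g where "g x = (\<lambda>v\<in>?V. inv x \<otimes> v \<otimes> x)" for x
  have gA: "g ` A \<subseteq> ?V \<rightarrow>\<^sub>E ?V"
    using V Ac(1) by (auto simp: g_def normal_subset_def subset_iff)
  have finE: "finite (?V \<rightarrow>\<^sub>E ?V)"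
    using finite_values by (intro finite_PiE)
  have "card (?V \<rightarrow>\<^sub>E ?V) = card ?V ^ card ?V"
    using finite_values by (rule card_funcsetE)
  \<comment> \<open>A base of at least 1 is required for raising the exponent to \<open>m\<close>
    afterwards.\<close>
  also have "\<dots> \<le> Suc m ^ card ?V"
    using card_values by (intro power_mono) auto
  also have "\<dots> \<le> Suc m ^ m"
    using card_values by (intro power_increasing) auto
  finally have cg: "card (g ` A) \<le> Suc m ^ m"
    using card_mono[OF finE gA] by linarith
  have "T #> x = T #> y" if xy: "x \<in> A" "y \<in> A" "g x = g y" for x y
  proof -
    have c: "x \<in> carrier G" "y \<in> carrier G"
      using xy Ac by auto
    let ?z = "x \<otimes> inv y"
    have "commutator G ?z v = \<one>" if v: "v \<in> ?V" for v
    proof -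
      have vc: "v \<in> carrier G"
        using v Vc by auto
      have e: "inv x \<otimes> v \<otimes> x = inv y \<otimes> v \<otimes> y"
        using fun_cong[OF xy(3), of v] v by (simp add: g_def)
      have "v \<otimes> ?z = x \<otimes> (inv x \<otimes> v \<otimes> x) \<otimes> inv y"
        using c vc by (simp add: m_assoc)
      also have "\<dots> = ?z \<otimes> v"
        unfolding e using c vc by (simp add: m_assoc)
      finally show ?thesis
        using c vc by (simp add: commute_iff_commutator)
    qed
    then have "?z \<in> C"
      using c by (intro centralize_values) (simp add: colon_def)
    moreover have "?z \<in> A"
      using xy Ac(3,4) by blast
    ultimately show ?thesis
      using AT rcoset_eq_iff[OF T c] by blast
  qed
  note factored = card_image_factor[of A g "(#>) T", OF this finite_subset[OF gA finE]]
  have "finite ((#>) T ` A)"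
    by (rule factored(1))
  moreover have "card ((#>) T ` A) \<le> Suc m ^ m"
    by (rule order_trans[OF factored(2) cg])
  ultimately show ?thesis
    by (simp add: bounded_index_def)
qed

text \<open>Passing to a child and from \<open>T\<close> to a \<open>colon\<close> carries the
  assumption down to the leaves, where it reads \<open>N i \<inter> C \<subseteq> T\<close> for the
  \<open>T\<close> reached there and the action on the values bounds the index. The relative theorem
  of Schur leads back up.\<close>

lemma bounded_index_iter_comm:
  assumes "distinct_leaves s" "T \<lhd> G"
    and "\<And>i. i \<in> leaves s \<Longrightarrow> iter_comm s (N(i := N i \<inter> C)) \<subseteq> T"
  shows "bounded_index T (iter_comm s N) (index_bound m s)"
  using assms
proof (induct s arbitrary: T)
  case (Lf i)
  then show ?case
    using bounded_index_centralizer[OF N_normal, of T i] by simp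
next
  case (Br a b)
  have nN: "iter_comm s N \<lhd> G" for s
    by (intro iter_comm_normal N_normal)
  have NC: "N j \<inter> C \<lhd> G" for j
    by (intro normal_subgroup_intersect N_normal C_normal)
  have col: "colon T (iter_comm s N) \<lhd> G" for s
    by (intro colon_normal Br.prems normal_subset_normal nN)
  have "bounded_index (colon T (iter_comm b N)) (iter_comm a N) (index_bound m a)"
  proof (rule Br.hyps)
    fix j assume "j \<in> leaves a"
    then show "iter_comm a (N(j := N j \<inter> C)) \<subseteq> colon T (iter_comm b N)"
      using Br.prems(3)[of j] iter_comm_Br_left[of a b N _ T j, OF Br.prems(1) N_normal NC Br.prems(2)]
      by (simp del: iter_comm.simps fun_upd_apply)
  qed (use Br.prems(1) col in simp_all)
  moreover have "bounded_index (colon T (iter_comm a N)) (iter_comm b N) (index_bound m b)"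
  proof (rule Br.hyps)
    fix j assume "j \<in> leaves b"
    then show "iter_comm b (N(j := N j \<inter> C)) \<subseteq> colon T (iter_comm a N)"
      using Br.prems(3)[of j] iter_comm_Br_right[of a b N _ T j, OF Br.prems(1) N_normal NC Br.prems(2)]
      by (simp del: iter_comm.simps fun_upd_apply)
  qed (use Br.prems(1) col in simp_all)
  ultimately show ?case
    using bounded_index_comm_sub[OF Br.prems(2) nN nN] by simp
qed

lemma pow_exponent_bound:
  assumes "x \<in> K"
  shows "x [^] exponent_bound m t (\<Prod>i\<in>leaves t. n i) = \<one>"
proof -
  define R where "R = Suc (card (subtrees t) * L)"
  have "defect C \<le> card (subtrees t)"
    unfolding defect_def by (intro card_mono) auto
  then have R: "Suc (defect C * L) \<le> R"
    unfolding R_def by (intro Suc_le_mono[THEN iffD2] mult_le_mono1)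
  have "iter_comm t (N(i := N i \<inter> C)) \<subseteq> torsion R" if "i \<in> leaves t" for i
    using shrink_centralizer[OF C_normal subset_refl that] torsion_mono[OF R] by blast
  then have "bounded_index (torsion R) K (index_bound m t)"
    by (intro bounded_index_iter_comm distinct_t torsion_normal)
  then have "x [^] (fact (index_bound m t) :: nat) \<in> torsion R"
    using assms by (intro bounded_index_pow[OF torsion_normal K_normal])
  then have 1: "(x [^] (fact (index_bound m t) :: nat)) [^] (e ^ R) \<in> comm_sub K K"
    by (simp add: torsion_def)
  have "bounded_index C K (Suc m ^ m)"
    by (intro bounded_index_centralizer K_normal C_normal) auto
  then have "bounded_index {\<one>} (comm_sub K K) (gen_bound (Suc m ^ m * Suc m ^ m) (fact (Suc m ^ m)))"
    by (intro bounded_index_comm_sub one_is_normal K_normal)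
  from bounded_index_pow[OF one_is_normal K'_normal this 1] show ?thesis
    using assms normal_closed(1)[OF K_normal]
    by (auto simp: nat_pow_pow exponent_bound_def R_def e_def L_def mult.assoc)
qed

lemma order_bound:
  shows "finite K" "card K \<le> order_bound m t (\<Prod>i\<in>leaves t. n i)"
proof -
  let ?V = "tree_values t S"
  let ?X = "?V \<union> m_inv G ` ?V"
  let ?f = "exponent_bound m t (\<Prod>i\<in>leaves t. n i)"
  have V: "normal_subset ?V G"
    using distinct_t S_normal by (rule tree_values_normal)
  then have Vc: "?V \<subseteq> carrier G"
    by (simp add: normal_subset_def)
  have VK: "?V \<subseteq> K"
    unfolding K_generate by (auto intro: generate.incl)
  have XK: "?X \<subseteq> K"
    using VK normal_closed(3)[OF K_normal] by auto
  have "inv g \<otimes> inv v \<otimes> g \<in> m_inv G ` ?V" if v: "v \<in> ?V" and g: "g \<in> carrier G" for v g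
  proof -
    have "inv g \<otimes> v \<otimes> g \<in> ?V"
      using V v g by (simp add: normal_subset_def)
    moreover have "inv g \<otimes> inv v \<otimes> g = inv (inv g \<otimes> v \<otimes> g)"
      using v g Vc by (auto simp: inv_mult_group m_assoc)
    ultimately show ?thesis
      by blast
  qed
  then have nX: "normal_subset ?X G"
    using V Vc by (auto simp: normal_subset_def)
  have "card ?X \<le> card ?V + card (m_inv G ` ?V)"
    by (rule card_Un_le)
  also have "\<dots> \<le> 2 * m"
    using card_image_le[OF finite_values, of "m_inv G"] card_values by simp
  finally have cX: "card ?X \<le> 2 * m" .
  have "generate G ?X = K"
  proof
    show "generate G ?X \<subseteq> K"
      using XK by (intro generate_subgroup_incl normal_imp_subgroup K_normal)
    show "K \<subseteq> generate G ?X"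
      unfolding K_generate by (intro mono_generate) simp
  qed
  moreover have "\<exists>ys. set ys \<subseteq> ?X \<and> length ys \<le> ?f \<and> x [^] Suc ?f = lprod ys" if x: "x \<in> ?X" for x
  proof (intro exI conjI)
    show "set [x] \<subseteq> ?X"
      using x by simp
    \<comment> \<open>The power \<open>x [^] Suc ?f\<close> equals \<open>x\<close>, a word of
      length 1; it is short enough only if \<open>?f\<close> is positive.\<close>
    have "(\<Prod>i\<in>leaves t. n i) > 0"
      using n_pos by (intro prod_pos) (simp add: Suc_le_eq)
    then show "length [x] \<le> ?f"
      by (simp add: exponent_bound_def Suc_le_eq)
    show "x [^] Suc ?f = lprod [x]"
    proof -
      have "x \<in> K" "x \<in> carrier G"
        using x XK normal_closed(1)[OF K_normal] by blast+
      then show ?thesis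
        using pow_exponent_bound[of x] by simp
    qed
  qed
  moreover have "inv x \<in> ?X" if "x \<in> ?X" for x
    using that Vc by auto
  moreover have "finite ?X"
    using finite_values by simp
  ultimately show "finite K" "card K \<le> order_bound m t (\<Prod>i\<in>leaves t. n i)"
    using generate_bounded[OF nX _ cX, of ?f] by (simp_all add: order_bound_def)
qed

end

section \<open>Countable groups suffice\<close>

primrec derived_tree :: "nat \<Rightarrow> nat \<Rightarrow> ctree" where
  "derived_tree 0 i = Lf i"
| "derived_tree (Suc k) i = Br (derived_tree k i) (derived_tree k (i + 2 ^ k))"

lemma leaves_derived_tree: "leaves (derived_tree k i) = {i..<i + 2 ^ k}"
  by (induct k arbitrary: i) auto

lemma distinct_leaves_derived_tree: "distinct_leaves (derived_tree k i)"
  by (induct k arbitrary: i) (auto simp: leaves_derived_tree)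

lemma derived_word_cong:
  "(\<And>i. i < 2 ^ k \<Longrightarrow> x i = y i) \<Longrightarrow> derived_word G k x = derived_word G k y"
proof (induct k arbitrary: x y)
  case (Suc k)
  have "derived_word G k x = derived_word G k y"
    by (intro Suc) auto
  moreover have "derived_word G k (\<lambda>i. x (2 ^ k + i)) = derived_word G k (\<lambda>i. y (2 ^ k + i))"
    by (intro Suc) auto
  ultimately show ?case
    by simp
qed simp

context group
begin

lemma derived_word_tree: "derived_word G k (\<lambda>j. x (i + j)) = tree_word (derived_tree k i) x"
  by (induct k arbitrary: i) (simp_all flip: add.assoc)

lemma word_values_tree:
  assumes "\<And>i. i < 2 ^ k \<Longrightarrow> X i = Y i"
  shows "word_values (2 ^ k) (derived_word G k) X = tree_values (derived_tree k 0) Y"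
  using derived_word_tree[of k _ 0] assms
  by (auto simp: word_values_def tree_values_def leaves_derived_tree)

lemma countable_generate:
  assumes "countable X" "X \<subseteq> carrier G"
  shows "countable (generate G X)"
proof -
  let ?Y = "X \<union> m_inv G ` X"
  have "generate G X \<subseteq> lprod ` lists ?Y"
  proof
    fix g assume "g \<in> generate G X"
    then have "g \<in> generate G ?Y"
      using mono_generate[of X ?Y] by auto
    then have "\<exists>xs. set xs \<subseteq> ?Y \<and> g = lprod xs"
      using assms(2) by (intro generate_eq_lprod) auto
    then show "g \<in> lprod ` lists ?Y"
      by (auto simp: lists_eq_set)
  qed
  then show ?thesis
    using assms(1) by (auto intro: countable_subset)
qed

end

lemma power_generated_tree:
  assumes "group G" "power_generated G (2 ^ k) N S n"
    and "finite (word_values (2 ^ k) (derived_word G k) S)"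
    and "card (word_values (2 ^ k) (derived_word G k) S) \<le> m"
  shows "power_generated_tree G (derived_tree k 0) (\<lambda>i. if i < 2 ^ k then S i else carrier G)
    (\<lambda>i. if i < 2 ^ k then N i else carrier G) (\<lambda>i. if i < 2 ^ k then n i else 1) m"
proof -
  interpret group G by fact
  note pg = assms(2)[unfolded power_generated_def, rule_format]
  have "normal_subset (carrier G) G"
    by (simp add: normal_subset_def)
  then show ?thesis
    using pg assms(3,4) word_values_tree[of k S "\<lambda>i. if i < 2 ^ k then S i else carrier G"]
    by unfold_locales
      (auto simp: distinct_leaves_derived_tree generate_subgroup_self subgroup_self)
qed

text \<open>Each \<open>N i\<close> is itself a normal generating set of \<open>N i\<close>, so the
  values on \<open>N\<close> and those on \<open>S\<close> generate the same subgroup. The first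
  form shows that the subgroup is recovered inside any subgroup that contains the values on
  \<open>S\<close>.\<close>

lemma word_subgroup_generate:
  assumes "group G" "power_generated G (2 ^ k) N S n"
    and "finite (word_values (2 ^ k) (derived_word G k) S)"
  shows "word_subgroup G (2 ^ k) (derived_word G k) N =
      generate G (word_values (2 ^ k) (derived_word G k) S)"
    and "word_subgroup G (2 ^ k) (derived_word G k) N =
      group.iter_comm G (derived_tree k 0) (\<lambda>i. if i < 2 ^ k then N i else carrier G)"
proof -
  let ?S = "\<lambda>i. if i < 2 ^ k then S i else carrier G"
  let ?N = "\<lambda>i. if i < 2 ^ k then N i else carrier G"
  interpret power_generated_tree G "derived_tree k 0" ?S ?N "\<lambda>i. if i < 2 ^ k then n i else 1"
    "card (word_values (2 ^ k) (derived_word G k) S)"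
    by (rule power_generated_tree[OF assms order_refl])
  have "?N = (\<lambda>i. generate G (?N i))"
    by (intro ext generate_subgroup_self[symmetric] normal_imp_subgroup N_normal)
  then have "K = generate G (tree_values (derived_tree k 0) ?N)"
    using iter_comm_generate[OF distinct_t, of ?N] normal_subset_normal[OF N_normal] by metis
  then show "word_subgroup G (2 ^ k) (derived_word G k) N = K"
    using word_values_tree[of k N ?N] by (simp add: word_subgroup_def)
  then show "word_subgroup G (2 ^ k) (derived_word G k) N =
      generate G (word_values (2 ^ k) (derived_word G k) S)"
    using word_values_tree[of k S ?S] K_generate by simp
qed

lemma word_subgroup_order_bound:
  assumes "group G" "power_generated G (2 ^ k) N S n"
    and "finite (word_values (2 ^ k) (derived_word G k) S)"
  shows "finite (word_subgroup G (2 ^ k) (derived_word G k) N)"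
    and "card (word_subgroup G (2 ^ k) (derived_word G k) N) \<le>
      order_bound (card (word_values (2 ^ k) (derived_word G k) S)) (derived_tree k 0) (\<Prod>i<2 ^ k. n i)"
proof -
  let ?S = "\<lambda>i. if i < 2 ^ k then S i else carrier G"
  let ?N = "\<lambda>i. if i < 2 ^ k then N i else carrier G"
  interpret power_generated_tree G "derived_tree k 0" ?S ?N "\<lambda>i. if i < 2 ^ k then n i else 1"
    "card (word_values (2 ^ k) (derived_word G k) S)"
    by (rule power_generated_tree[OF assms order_refl])
  have "(\<Prod>i\<in>leaves (derived_tree k 0). if i < 2 ^ k then n i else 1) = (\<Prod>i<2 ^ k. n i)"
    by (intro prod.cong) (auto simp: leaves_derived_tree)
  then show "finite (word_subgroup G (2 ^ k) (derived_word G k) N)"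
    and "card (word_subgroup G (2 ^ k) (derived_word G k) N) \<le>
      order_bound (card (word_values (2 ^ k) (derived_word G k) S)) (derived_tree k 0) (\<Prod>i<2 ^ k. n i)"
    using order_bound word_subgroup_generate(2)[OF assms] by simp_all
qed

section \<open>Transfer to groups on the natural numbers\<close>

lemma derived_word_hom:
  assumes "subgroup H G" "group G" "group_hom (G\<lparr>carrier := H\<rparr>) G' f"
    and "\<And>i. i < 2 ^ k \<Longrightarrow> x i \<in> H"
  shows "derived_word G k x \<in> H \<and> f (derived_word G k x) = derived_word G' k (f \<circ> x)"
  using assms(4)
proof (induct k arbitrary: x)
  case 0
  then show ?case by simp
next
  case (Suc k)
  interpret group G by fact
  interpret f: group_hom "G\<lparr>carrier := H\<rparr>" G' f by fact
  interpret H: subgroup H G by fact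
  let ?u = "derived_word G k x" and ?v = "derived_word G k (\<lambda>i. x (2 ^ k + i))"
  have u: "?u \<in> H" "f ?u = derived_word G' k (f \<circ> x)"
    using Suc.hyps[of x] Suc.prems by (auto simp: comp_def)
  have v: "?v \<in> H" "f ?v = derived_word G' k (\<lambda>i. (f \<circ> x) (2 ^ k + i))"
    using Suc.hyps[of "\<lambda>i. x (2 ^ k + i)"] Suc.prems by (auto simp: comp_def)
  have mult: "f (a \<otimes>\<^bsub>G\<^esub> b) = f a \<otimes>\<^bsub>G'\<^esub> f b" if "a \<in> H" "b \<in> H" for a b
    using f.hom_mult[of a b] that by simp
  have hinv: "f (inv\<^bsub>G\<^esub> a) = inv\<^bsub>G'\<^esub> (f a)" if "a \<in> H" for a
    using f.hom_inv[of a] that assms(1) by simp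
  have "f (commutator G ?u ?v) = commutator G' (f ?u) (f ?v)"
    using u(1) v(1) by (simp add: commutator_def mult hinv)
  moreover have "commutator G ?u ?v \<in> H"
    using u(1) v(1) by (simp add: commutator_def)
  ultimately show ?case
    using u v by (simp add: comp_def)
qed

lemma countable_group_copy:
  assumes "group M" "countable (carrier M)"
  shows "\<exists>(G' :: nat monoid) f. group_hom M G' f \<and> inj_on f (carrier M) \<and> f ` carrier M = carrier G'"
proof -
  interpret M: group M by fact
  define f where "f = to_nat_on (carrier M)"
  define g where "g = inv_into (carrier M) f"
  have inj: "inj_on f (carrier M)"
    using assms(2) by (auto simp: f_def)
  have g: "g (f x) = x" if "x \<in> carrier M" for x
    using inj that by (simp add: g_def)
  define G' where "G' = \<lparr>carrier = f ` carrier M, mult = (\<lambda>x y. f (g x \<otimes>\<^bsub>M\<^esub> g y)), one = f \<one>\<^bsub>M\<^esub>\<rparr>"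
  have "group G'"
  proof (rule groupI)
    fix x assume "x \<in> carrier G'"
    then obtain y where "y \<in> carrier M" "x = f y"
      by (auto simp: G'_def)
    then show "\<exists>y\<in>carrier G'. y \<otimes>\<^bsub>G'\<^esub> x = \<one>\<^bsub>G'\<^esub>"
      by (intro bexI[of _ "f (inv\<^bsub>M\<^esub> y)"]) (auto simp: G'_def g)
  qed (auto simp: G'_def g M.m_assoc)
  then have "group_hom M G' f"
    using assms(1) by (intro group_hom.intro group_hom_axioms.intro) (auto simp: hom_def G'_def g)
  then show ?thesis
    using inj by (intro exI[of _ G'] exI[of _ f]) (simp add: G'_def)
qed

text \<open>
  The subgroup \<open>H\<close> generated by the entries of finitely many tuples that realise all values on \<open>S\<close> is
  countable, and \<open>S i \<inter> H\<close>, \<open>i < 2 ^ k\<close>, satisfy the hypotheses in \<open>H\<close> with the same set of values.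
\<close>

lemma power_generated_nat_copy:
  fixes G :: "'a monoid"
  assumes "group G" "power_generated G (2 ^ k) N S n"
    and fin: "finite (word_values (2 ^ k) (derived_word G k) S)"
  shows "\<exists>(G' :: nat monoid) N' S'. group G' \<and> power_generated G' (2 ^ k) N' S' n \<and>
    finite (word_values (2 ^ k) (derived_word G' k) S') \<and>
    card (word_values (2 ^ k) (derived_word G' k) S') = card (word_values (2 ^ k) (derived_word G k) S) \<and>
    card (word_subgroup G' (2 ^ k) (derived_word G' k) N') =
      card (word_subgroup G (2 ^ k) (derived_word G k) N)"
proof -
  interpret group G by fact
  let ?r = "2 ^ k :: nat"
  let ?V = "word_values ?r (derived_word G k) S"
  note pg = assms(2)[unfolded power_generated_def, rule_format]
  have "\<forall>v\<in>?V. \<exists>x. (\<forall>i<?r. x i \<in> S i) \<and> v = derived_word G k x"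
    by (auto simp: word_values_def)
  then obtain w where w: "\<And>v i. v \<in> ?V \<Longrightarrow> i < ?r \<Longrightarrow> w v i \<in> S i"
    "\<And>v. v \<in> ?V \<Longrightarrow> v = derived_word G k (w v)"
    by metis
  have Sc: "S i \<subseteq> carrier G" if "i < ?r" for i
    using pg that by (auto simp: normal_subset_def)
  define W where "W = (\<Union>v\<in>?V. w v ` {..<?r})"
  have W: "finite W" "W \<subseteq> carrier G"
    using fin w(1) Sc by (auto simp: W_def)
  define H where "H = generate G W"
  have H: "subgroup H G"
    unfolding H_def using W(2) by (rule generate_is_subgroup)
  interpret H: subgroup H G by fact
  let ?M = "G\<lparr>carrier := H\<rparr>"
  have "countable H"
    unfolding H_def using W by (intro countable_generate countable_finite)
  then obtain G' :: "nat monoid" and f where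
    f: "group_hom ?M G' f" "inj_on f H" "f ` H = carrier G'"
    using countable_group_copy[of ?M] H.subgroup_is_group[OF assms(1)] by auto
  interpret f: group_hom ?M G' f by fact
  define T where "T i = S i \<inter> H" for i
  define S' where "S' i = f ` T i" for i
  \<comment> \<open>\<open>N i \<inter> H\<close> may be larger than the subgroup generated by
    \<open>S i \<inter> H\<close>, so \<open>N'\<close> is defined by generation. Its elements still
    come from \<open>N i \<inter> H\<close>, and therefore their powers land in
    \<open>S'\<close>.\<close>
  define N' where "N' i = generate G' (S' i)" for i
  have T_gen: "generate G (T i) \<subseteq> N i" "generate G (T i) \<subseteq> H" if "i < ?r" for i
    using pg[OF that] mono_generate[of "T i" "S i"] generate_subgroup_incl[OF _ H, of "T i"]
    by (auto simp: T_def)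
  have S'_normal: "normal_subset (S' i) G'" if i: "i < ?r" for i
    unfolding normal_subset_def
  proof (intro conjI ballI)
    show "S' i \<subseteq> carrier G'"
      using f(3) by (auto simp: S'_def T_def)
    fix g s assume "g \<in> carrier G'" "s \<in> S' i"
    moreover have "carrier G' = f ` H"
      using f(3) by simp
    ultimately obtain h u where hu: "h \<in> H" "g = f h" "u \<in> S i" "u \<in> H" "s = f u"
      unfolding S'_def T_def by blast
    have "inv\<^bsub>G\<^esub> h \<otimes>\<^bsub>G\<^esub> u \<otimes>\<^bsub>G\<^esub> h \<in> T i"
      using pg[OF i] hu by (auto simp: T_def normal_subset_def)
    moreover have "inv\<^bsub>G'\<^esub> g \<otimes>\<^bsub>G'\<^esub> s \<otimes>\<^bsub>G'\<^esub> g = f (inv\<^bsub>G\<^esub> h \<otimes>\<^bsub>G\<^esub> u \<otimes>\<^bsub>G\<^esub> h)"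
      using hu H f.hom_mult[of "inv\<^bsub>G\<^esub> h \<otimes>\<^bsub>G\<^esub> u" h] f.hom_mult[of "inv\<^bsub>G\<^esub> h" u] f.hom_inv[of h] by simp
    ultimately show "inv\<^bsub>G'\<^esub> g \<otimes>\<^bsub>G'\<^esub> s \<otimes>\<^bsub>G'\<^esub> g \<in> S' i"
      by (auto simp: S'_def)
  qed
  have T_img: "N' i = f ` generate G (T i)" if "i < ?r" for i
    using f.generate_img[of "T i"] generate_consistent[of "T i" H] H by (simp add: N'_def S'_def T_def)
  have pg': "power_generated G' ?r N' S' n"
    unfolding power_generated_def
  proof (intro allI impI conjI ballI)
    fix i assume i: "i < ?r"
    show "N' i \<lhd> G'"
      unfolding N'_def using S'_normal[OF i] by (rule f.H.normal_generate)
    show "N' i = generate G' (S' i)"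
      by (rule N'_def)
    show "normal_subset (S' i) G'"
      using i by (rule S'_normal)
    show "1 \<le> n i"
      using pg[OF i] by simp
    fix x assume "x \<in> N' i"
    then obtain y where y: "y \<in> generate G (T i)" "x = f y"
      using T_img[OF i] by auto
    then have yN: "y \<in> N i" "y \<in> H"
      using T_gen[OF i] by auto
    then have "y [^]\<^bsub>G\<^esub> n i \<in> T i"
      using pg[OF i] H by (auto simp: T_def nat_pow_mem_subgroup)
    moreover have "f (y [^]\<^bsub>G\<^esub> n i) = x [^]\<^bsub>G'\<^esub> n i"
      using f.hom_nat_pow[of y "n i"] yN(2) y(2) nat_pow_consistent[of y "n i" H] by simp
    ultimately show "x [^]\<^bsub>G'\<^esub> n i \<in> S' i"
      unfolding S'_def by (metis imageI)
  qed
  have VT: "?V = word_values ?r (derived_word G k) T"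
  proof
    show "word_values ?r (derived_word G k) T \<subseteq> ?V"
      by (auto simp: word_values_def T_def)
    show "?V \<subseteq> word_values ?r (derived_word G k) T"
    proof
      fix v assume v: "v \<in> ?V"
      have "w v i \<in> T i" if "i < ?r" for i
        using w(1)[OF v that] v that by (auto simp: T_def H_def W_def intro!: generate.incl)
      then show "v \<in> word_values ?r (derived_word G k) T"
        using w(2)[OF v] by (auto simp: word_values_def)
    qed
  qed
  have word: "derived_word G k x \<in> H \<and> f (derived_word G k x) = derived_word G' k (f \<circ> x)"
    if "\<forall>i<?r. x i \<in> T i" for x
    using that by (intro derived_word_hom[OF H assms(1) f(1)]) (auto simp: T_def)
  have VH: "?V \<subseteq> H"
    unfolding VT using word by (auto simp: word_values_def)
  have V': "word_values ?r (derived_word G' k) S' = f ` ?V"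
  proof
    show "f ` ?V \<subseteq> word_values ?r (derived_word G' k) S'"
      unfolding VT using word by (force simp: word_values_def S'_def)
    show "word_values ?r (derived_word G' k) S' \<subseteq> f ` ?V"
    proof
      fix v assume "v \<in> word_values ?r (derived_word G' k) S'"
      then obtain y where y: "\<forall>i<?r. y i \<in> S' i" "v = derived_word G' k y"
        by (auto simp: word_values_def)
      then have "\<forall>i. \<exists>u. i < ?r \<longrightarrow> u \<in> T i \<and> y i = f u"
        by (auto simp: S'_def)
      then obtain x where x: "\<And>i. i < ?r \<Longrightarrow> x i \<in> T i \<and> y i = f (x i)"
        by metis
      have "v = derived_word G' k (f \<circ> x)"
        unfolding y(2) using x by (intro derived_word_cong) auto
      then have "v = f (derived_word G k x)"
        using word[of x] x by simp
      then show "v \<in> f ` ?V"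
        unfolding VT using x by (auto simp: word_values_def)
    qed
  qed
  \<comment> \<open>Even if \<open>N'\<close> is smaller than the image of
    \<open>N i \<inter> H\<close>, nothing is lost: both subgroups are generated by the values on
    the generating sets, and these correspond under \<open>f\<close>.\<close>
  have "word_subgroup G' ?r (derived_word G' k) N' = generate G' (f ` ?V)"
    using word_subgroup_generate(1)[OF f.H.group_axioms pg'] fin by (simp add: V')
  also have "\<dots> = f ` generate G ?V"
    using f.generate_img[of ?V] generate_consistent[OF VH H] VH by simp
  also have "generate G ?V = word_subgroup G ?r (derived_word G k) N"
    using word_subgroup_generate(1)[OF assms] by simp
  finally have "word_subgroup G' ?r (derived_word G' k) N' = f ` word_subgroup G ?r (derived_word G k) N" .
  moreover have "word_subgroup G ?r (derived_word G k) N \<subseteq> H"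
    unfolding word_subgroup_generate(1)[OF assms] using VH H by (rule generate_subgroup_incl)
  ultimately have "card (word_subgroup G' ?r (derived_word G' k) N') =
      card (word_subgroup G ?r (derived_word G k) N)"
    using card_image[OF inj_on_subset[OF f(2)]] by simp
  moreover have "card (word_values ?r (derived_word G' k) S') = card ?V"
    unfolding V' using VH f(2) by (intro card_image) (rule inj_on_subset)
  ultimately show ?thesis
    using f.H.group_axioms pg' fin V' by (intro exI[of _ G'] exI[of _ N'] exI[of _ S']) simp
qed

theorem theorem3p6:
  shows "(\<exists>B. derived_order_bound TYPE('a) B) \<and>
         (\<forall>B. derived_order_bound TYPE(nat) B \<longrightarrow> derived_order_bound TYPE('a) B)"
proof (intro conjI allI impI)
  \<comment> \<open>The exponents enter the bound only through their product.\<close>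
  let ?B = "\<lambda>m k ns. order_bound m (derived_tree k 0) (prod_list ns)"
  have ns: "prod_list (map n [0..<2 ^ k]) = (\<Prod>i<2 ^ k. n i)" for n :: "nat \<Rightarrow> nat" and k
    using prod.distinct_set_conv_list[of "[0..<2 ^ k]" n] by (simp add: atLeast0LessThan)
  have "derived_order_bound TYPE('a) ?B"
    unfolding derived_order_bound_def ns using word_subgroup_order_bound by blast
  then show "\<exists>B. derived_order_bound TYPE('a) B"
    by blast
next
  fix B assume B: "derived_order_bound TYPE(nat) B"
  show "derived_order_bound TYPE('a) B"
    unfolding derived_order_bound_def
  proof (intro allI impI)
    fix k :: nat and G :: "'a monoid" and N S n m
    assume k: "1 \<le> k" and G: "group G \<and> power_generated G (2 ^ k) N S n \<and>
      finite (word_values (2 ^ k) (derived_word G k) S) \<and>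
      card (word_values (2 ^ k) (derived_word G k) S) = m"
    then obtain G' :: "nat monoid" and N' S' where "group G'" "power_generated G' (2 ^ k) N' S' n"
      "finite (word_values (2 ^ k) (derived_word G' k) S')"
      "card (word_values (2 ^ k) (derived_word G' k) S') = m"
      "card (word_subgroup G' (2 ^ k) (derived_word G' k) N') =
        card (word_subgroup G (2 ^ k) (derived_word G k) N)"
      using power_generated_nat_copy[of G k N S n] by auto
    then have "card (word_subgroup G (2 ^ k) (derived_word G k) N) \<le> B m k (map n [0..<2 ^ k])"
      using B k unfolding derived_order_bound_def by metis
    \<comment> \<open>An infinite set has \<open>card\<close> 0, so the inequality obtained from the
      copy says nothing about finiteness; that comes from the explicit bound over
      \<open>'a\<close>.\<close>
    then show "finite (word_subgroup G (2 ^ k) (derived_word G k) N) \<and>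
        card (word_subgroup G (2 ^ k) (derived_word G k) N) \<le> B m k (map n [0..<2 ^ k])"
      using word_subgroup_order_bound(1) G by blast
  qed
qed

end
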